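(* Let $P$ be a triangulation of the boundary of a convex polyhedron in $\mathbb{R}^3$, equipped with a metric $d$ compatible with the topology of $P$. Let $f\colon P \to \mathbb{R}^2$ be a continuous map which is affine on each triangle of $P$ and of general position. Then there exists a polygonal path of $f$-neighbors in the complex of $f$-neighbors $\mathfrak{F}_f\subset P\times P$ that connects a pair of antipodal points with a pair of identical points; that is, a polygonal path in $\mathfrak{F}_f$ from a point $(p,q)$ with $p$ and $q$ antipodal (with respect to the center of $P$) to a point of the form $(r,r)$.
   Context: Triangulation: $P$ is a simplicial complex (with flat triangles in $\mathbb{R}^3$) whose underlying set is the boundary of the (3-dimensional, compact) convex polyhedron; $P$ also denotes this underlying set. The map $f$ is of general position if no three images of vertices of $P$ lie on a common line. Points $a,b\in P$ (not necessarily distinct) are $f$-neighbors if $f(a)=f(b)$. Induced triangulation $T_fP$: (1) Let $V\subset\mathbb{R}^2$ be the set of intersection points of images under $f$ of distinct edges of $P$. Let $C$ be the set of segments into which the images of the edges of $P$ are subdivided by the points of $V$. Take a constrained Delaunay triangulation with vertex set $V$ and constraint segments $C$, and let $T$ be the family of those of its simplices that are contained in $f(P)$; $T$ is a triangulation of $f(P)$. (2) For each triangle $t$ of $T$, take the closure of the preimage under $f$ of the relative interior of $t$; this is a union of triangles, each lying in a triangle of $P$ and mapped by $f$ affinely and bijectively onto $t$. $T_fP$ is the triangulation of $P$ consisting of all triangles so obtained, with their edges and vertices. Complex of $f$-neighbors $\mathfrak{F}_f$: for any two distinct triangles $\mathcal{A},\mathcal{B}$ of $T_fP$ with $f(\mathcal{A})=f(\mathcal{B})$,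 let $[\mathcal{A},\mathcal{B}]=\{(a,b)\in\mathcal{A}\times\mathcal{B}: f(a)=f(b)\}$ and $[\mathcal{B},\mathcal{A}]=\{(b,a)\in\mathcal{B}\times\mathcal{A}: f(a)=f(b)\}$, which are triangles in $P\times P\subset\mathbb{R}^3\times\mathbb{R}^3$. $\mathfrak{F}_f$ is the family of all such triangles together with their edges and vertices. Antipodal points: let $B$ be the convex polyhedron with boundary $P$. For $c\in\operatorname{Int}B$ let $\sigma_c\colon P\to P$ be the involution exchanging the two intersection points with $P$ of each line through $c$. Set $\mathcal{D}(P,d)=\sup_{c\in\operatorname{Int}B}\inf_{x\in P}d(x,\sigma_c(x))$. A point $c$ for which this supremum is achieved is called the center of $P$; points $a,b\in P$ are antipodal if $a=\sigma_c(b)$, where $c$ is the center of $P$. *)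

theory Defs
  imports "HOL-Analysis.Analysis"
begin

text \<open>Simplicial complexes are those of \<^const>\<open>simplicial_complex\<close>: they are closed under
  all faces, so a nonempty complex also has the empty set (the \<open>-1\<close>-simplex) as a member.\<close>

definition affine_map_on :: "'a::real_vector set \<Rightarrow> ('a \<Rightarrow> 'b::real_vector) \<Rightarrow> bool" where
  "affine_map_on S f \<longleftrightarrow> (\<exists>h b. linear h \<and> (\<forall>x\<in>S. f x = h x + b))"

text \<open>The vertices are required to be distinct, their images are not; as \<^const>\<open>collinear\<close>
  holds for at most two points, general position forces \<open>f\<close> to be injective on the vertices (if
  there are at least three) and on each triangle.\<close>

definition general_position :: "'a::euclidean_space set set \<Rightarrow> ('a \<Rightarrow> 'b::euclidean_space) \<Rightarrow> bool" where
  "general_position K f \<longleftrightarrow>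
     (\<forall>u v w. {u} \<in> K \<and> {v} \<in> K \<and> {w} \<in> K \<and> u \<noteq> v \<and> u \<noteq> w \<and> v \<noteq> w
        \<longrightarrow> \<not> collinear {f u, f v, f w})"


subsection \<open>Constrained Delaunay triangulations\<close>

definition visible :: "(real^2) set set \<Rightarrow> real^2 \<Rightarrow> real^2 \<Rightarrow> bool" where
  "visible C x v \<longleftrightarrow> (\<forall>s\<in>C. s \<inter> open_segment x v = {})"

text \<open>A triangulation of the convex hull of \<open>V\<close> with vertex set \<open>V\<close> that has the segments of
  \<open>C\<close> among its edges, such that the open disk bounded by the circumcircle of a triangle contains
  no vertex that is visible from the interior of the triangle. It need not be unique.\<close>

definition constrained_delaunay ::
    "(real^2) set \<Rightarrow> (real^2) set set \<Rightarrow> (real^2) set set \<Rightarrow> bool" where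
  "constrained_delaunay V C D \<longleftrightarrow>
     simplicial_complex D \<and> \<Union>D = convex hull V \<and> {v. {v} \<in> D} = V \<and> C \<subseteq> D \<and>
     (\<forall>t\<in>D. 2 simplex t \<longrightarrow>
        (\<forall>z r. {w. w extreme_point_of t} \<subseteq> sphere z r \<longrightarrow>
           (\<forall>v\<in>V. \<forall>x\<in>interior t. visible C x v \<longrightarrow> v \<notin> ball z r)))"


subsection \<open>The induced triangulation\<close>

definition crossing_points :: "(real^3) set set \<Rightarrow> (real^3 \<Rightarrow> real^2) \<Rightarrow> (real^2) set" where
  "crossing_points K f =
     {x. \<exists>e\<in>K. \<exists>e'\<in>K. 1 simplex e \<and> 1 simplex e' \<and> e \<noteq> e' \<and> x \<in> f ` e \<and> x \<in> f ` e'}"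

definition edge_image_segments :: "(real^3) set set \<Rightarrow> (real^3 \<Rightarrow> real^2) \<Rightarrow> (real^2) set set" where
  "edge_image_segments K f =
     {closed_segment a b | a b. a \<noteq> b \<and> a \<in> crossing_points K f \<and> b \<in> crossing_points K f \<and>
        open_segment a b \<inter> crossing_points K f = {} \<and>
        (\<exists>e\<in>K. 1 simplex e \<and> closed_segment a b \<subseteq> f ` e)}"

definition is_cdt_of_image ::
    "(real^3) set set \<Rightarrow> (real^3 \<Rightarrow> real^2) \<Rightarrow> (real^2) set set \<Rightarrow> bool" where
  "is_cdt_of_image K f D \<longleftrightarrow>
     constrained_delaunay (crossing_points K f) (edge_image_segments K f) D"

definition image_triangulation ::
    "(real^3) set set \<Rightarrow> (real^3 \<Rightarrow> real^2) \<Rightarrow> (real^2) set set \<Rightarrow> (real^2) set set" where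
  "image_triangulation K f D = {s\<in>D. s \<subseteq> f ` (\<Union>K)}"

text \<open>The triangles of the induced triangulation of \<open>\<Union>K\<close>; that \<open>f\<close> is affine on them
  follows from \<open>A \<subseteq> S\<close>.\<close>

definition induced_triangles ::
    "(real^3) set set \<Rightarrow> (real^3 \<Rightarrow> real^2) \<Rightarrow> (real^2) set set \<Rightarrow> (real^3) set set" where
  "induced_triangles K f D =
     {A. 2 simplex A \<and>
         (\<exists>t\<in>image_triangulation K f D. 2 simplex t \<and>
            A \<subseteq> closure {x \<in> \<Union>K. f x \<in> rel_interior t} \<and>
            (\<exists>S\<in>K. 2 simplex S \<and> A \<subseteq> S) \<and> bij_betw f A t)}"


subsection \<open>The complex of neighbors\<close>

definition neighbor_triangle ::
    "('a \<Rightarrow> 'b) \<Rightarrow> 'a set \<Rightarrow> 'a set \<Rightarrow> ('a \<times> 'a) set" where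
  "neighbor_triangle f A B = {(a, b). a \<in> A \<and> b \<in> B \<and> f a = f b}"

definition neighbor_complex ::
    "(real^3) set set \<Rightarrow> (real^3 \<Rightarrow> real^2) \<Rightarrow> (real^2) set set \<Rightarrow> ((real^3) \<times> (real^3)) set set" where
  "neighbor_complex K f D =
     {F. F \<noteq> {} \<and>
         (\<exists>A\<in>induced_triangles K f D. \<exists>B\<in>induced_triangles K f D.
            A \<noteq> B \<and> f ` A = f ` B \<and> F face_of neighbor_triangle f A B)}"

inductive polygonal_path :: "(real \<Rightarrow> 'a::real_normed_vector) \<Rightarrow> bool" where
  "polygonal_path (linepath a b)"
| "polygonal_path g \<Longrightarrow> pathstart g = b \<Longrightarrow> polygonal_path (linepath a b +++ g)"


subsection \<open>Centers and antipodal points\<close>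

text \<open>For \<open>c\<close> in the interior of a convex body \<open>B\<close> and \<open>x\<close> in its frontier, the line
  through \<open>x\<close> and \<open>c\<close> meets the frontier in exactly two points; this is the other one.\<close>

definition opposite :: "'a::euclidean_space set \<Rightarrow> 'a \<Rightarrow> 'a \<Rightarrow> 'a" where
  "opposite B c x = (THE y. y \<noteq> x \<and> affine hull {c, x} \<inter> frontier B = {x, y})"

definition min_opposite_dist ::
    "'a::euclidean_space set \<Rightarrow> ('a \<Rightarrow> 'a \<Rightarrow> real) \<Rightarrow> 'a \<Rightarrow> real" where
  "min_opposite_dist B d c = (INF x\<in>frontier B. d x (opposite B c x))"

text \<open>For a metric inducing the topology of the (compact) frontier all distances are bounded, so
  the suprema and infima are those of nonempty bounded sets of reals.\<close>

definition opposite_width :: "'a::euclidean_space set \<Rightarrow> ('a \<Rightarrow> 'a \<Rightarrow> real) \<Rightarrow> real" where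
  "opposite_width B d = (SUP c\<in>interior B. min_opposite_dist B d c)"

definition is_center :: "'a::euclidean_space set \<Rightarrow> ('a \<Rightarrow> 'a \<Rightarrow> real) \<Rightarrow> 'a \<Rightarrow> bool" where
  "is_center B d c \<longleftrightarrow> c \<in> interior B \<and> min_opposite_dist B d c = opposite_width B d"

definition antipodal :: "'a::euclidean_space set \<Rightarrow> 'a \<Rightarrow> 'a \<Rightarrow> 'a \<Rightarrow> bool" where
  "antipodal B c a b \<longleftrightarrow> a \<in> frontier B \<and> b \<in> frontier B \<and> a = opposite B c b"

end

theory Submission
  imports Defs
begin

text \<open>
  Let \<open>N\<close> be the set of all \<open>(a, b)\<close> with \<open>f a = f b\<close>. By general position every pair of
  distinct points in \<open>N\<close> lies in a triangle of the complex of neighbors. So if no polygonal path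
  as claimed exists, then \<open>N\<close> is the union of two disjoint closed sets \<open>N1\<close> and \<open>N2\<close>, symmetric
  under exchange of coordinates, where \<open>N1\<close> contains the diagonal and no antipodal pair.

  This is impossible for every continuous \<open>f\<close>. The unit quaternions \<open>y\<close> parametrize orthonormal
  pairs \<open>(x, v)\<close> in \<open>\<real>\<^sup>3\<close>; projecting \<open>s v + (1 - s) x\<close> and \<open>s v - (1 - s) x\<close> radially from
  \<open>c\<close> to the frontier gives pairs \<open>(a, b)\<close> that are antipodal for \<open>s = 0\<close> and identical for
  \<open>s = 1\<close>, and right multiplication by the quaternion \<open>j\<close>, which has order 4, exchanges \<open>a\<close> and
  \<open>b\<close>. Let \<open>g = f a - f b\<close>, a complex number, and let \<open>h\<close> be a symmetric real function that is
  negative on \<open>N1\<close> and positive on \<open>N2\<close>. The nowhere vanishing \<open>(g, h)\<close> is a map to the 2-sphere.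
  It avoids the south pole for \<open>s = 0\<close>, so there it lifts through the Hopf fibration; the lift
  extends to all \<open>s\<close>. Comparing the lift at \<open>y\<close> and \<open>y j\<close> yields a function \<open>q\<close> whose product
  over each orbit is 1, with \<open>q = 1\<close> for \<open>s = 0\<close>. As the 3-sphere is simply connected, \<open>q\<close> has a
  logarithm, and its sum over an orbit does not depend on \<open>y\<close> and \<open>s\<close>. It is a multiple of
  \<open>8\<pi>i\<close> for \<open>s = 0\<close> and an odd multiple of \<open>4\<pi>i\<close> for \<open>s = 1\<close>.\<close>

subsection \<open>Lifting through the Hopf fibration\<close>

text \<open>The values of \<open>w\<close> lie in the discrete set of multiples of
  \<open>2\<pi>i\<close>, where distinct points have distance at least \<open>2\<pi>\<close>; a
  continuous function with such values is constant on a connected set.\<close>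

lemma exp_eq_1_imp_constant:
  fixes w :: "'a::topological_space \<Rightarrow> complex"
  assumes "connected S" "continuous_on S w" "\<And>x. x \<in> S \<Longrightarrow> exp (w x) = 1"
  obtains n :: int where "\<And>x. x \<in> S \<Longrightarrow> w x = 2 * of_int n * of_real pi * \<i>"
proof -
  have int: "\<exists>n::int. w x = 2 * of_int n * of_real pi * \<i>" if "x \<in> S" for x
    using assms(3)[OF that] unfolding exp_eq_1
    by (auto simp: complex_eq_iff mult_ac)
  have "w constant_on S"
  proof (rule continuous_discrete_range_constant[OF assms(1,2)])
    fix x assume x: "x \<in> S"
    have "2 * pi \<le> norm (w y - w x)" if y: "y \<in> S" "w y \<noteq> w x" for y
    proof -
      obtain m n :: int where mn: "w x = 2 * of_int m * of_real pi * \<i>"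
          "w y = 2 * of_int n * of_real pi * \<i>"
        using int x y by meson
      have "w y - w x = of_real (2 * pi * of_int (n - m)) * \<i>"
        by (simp add: mn algebra_simps)
      then have "norm (w y - w x) = 2 * pi * \<bar>of_int (n - m)\<bar>"
        by (simp only: norm_mult norm_of_real norm_ii abs_mult) simp
      moreover have "n \<noteq> m" using mn y by auto
      then have "1 \<le> \<bar>n - m\<bar>" by linarith
      then have "1 \<le> \<bar>real_of_int (n - m)\<bar>" by linarith
      then have "2 * pi * 1 \<le> 2 * pi * \<bar>real_of_int (n - m)\<bar>"
        by (intro mult_left_mono) auto
      ultimately show ?thesis by simp
    qed
    then show "\<exists>e>0. \<forall>y. y \<in> S \<and> w y \<noteq> w x \<longrightarrow> e \<le> norm (w y - w x)"
      by (intro exI[of _ "2 * pi"]) auto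
  qed
  then obtain k where k: "\<And>x. x \<in> S \<Longrightarrow> w x = k" by (auto simp: constant_on_def)
  show ?thesis
  proof (cases "S = {}")
    case False
    then show ?thesis using k int that by (metis equals0I)
  qed (use that in auto)
qed

text \<open>For \<open>\<bar>g\<bar>\<^sup>2 + h\<^sup>2 = 1\<close> the solutions of the two equations form the eigenspace for the
  eigenvalue \<open>1\<close> of the Hermitian involution with rows \<open>(-h, g)\<close> and \<open>(cnj g, h)\<close>; this is the
  line over \<open>(g, h)\<close> in the Hopf fibration.\<close>

definition eigenpair :: "complex \<Rightarrow> real \<Rightarrow> complex \<Rightarrow> complex \<Rightarrow> bool" where
  "eigenpair g h u v \<longleftrightarrow>
     (1 + of_real h) * u = g * v \<and> cnj g * u = (1 - of_real h) * v"

text \<open>With \<open>M\<close> the involution whose rows are \<open>(-h, g)\<close> and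
  \<open>(cnj g, h)\<close>, the new vector is \<open>(1 + M) (u, v)\<close>, and
  \<open>M (1 + M) = 1 + M\<close> because \<open>M\<close> squares to the identity.\<close>

lemma eigenpair_projection:
  assumes "(cmod g)\<^sup>2 + h\<^sup>2 = 1"
  shows "eigenpair g h ((1 - of_real h) * u + g * v) (cnj g * u + (1 + of_real h) * v)"
proof -
  have "g * cnj g = of_real (1 - h\<^sup>2)"
    using assms by (metis complex_norm_square eq_diff_eq of_real_power)
  then have "g * cnj g = 1 - of_real h * of_real h"
    by (simp add: power2_eq_square)
  then show ?thesis
    unfolding eigenpair_def
    by algebra
qed

text \<open>Let \<open>M\<close> and \<open>M'\<close> be the matrices for \<open>(g, h)\<close> and
  \<open>(g', h')\<close>. If \<open>1 + M'\<close> annihilated the fixed vector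
  \<open>(u, v)\<close> of \<open>M\<close>, then \<open>M' - M\<close> would multiply it by -2,
  which is too much for a matrix with all entries below 1/2 in modulus.\<close>

lemma eigenpair_projection_nonzero:
  assumes "eigenpair g h u v" "u \<noteq> 0 \<or> v \<noteq> 0"
    and "cmod (g' - g) < 1/2" "\<bar>h' - h\<bar> < 1/2"
  shows "(1 - of_real h') * u + g' * v \<noteq> 0 \<or> cnj g' * u + (1 + of_real h') * v \<noteq> 0"
proof (rule ccontr)
  assume "\<not> ?thesis"
  then have 0: "(1 - of_real h') * u + g' * v = 0" "cnj g' * u + (1 + of_real h') * v = 0"
    by auto
  have e: "(1 + of_real h) * u = g * v" "cnj g * u = (1 - of_real h) * v"
    using assms(1) by (auto simp: eigenpair_def)
  have "2 * u = of_real (h' - h) * u - (g' - g) * v"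
    using 0 e by (simp, algebra)
  then have 1: "2 * cmod u \<le> \<bar>h' - h\<bar> * cmod u + cmod (g' - g) * cmod v"
    by (metis norm_mult norm_numeral norm_of_real norm_triangle_ineq4)
  have "2 * v = - of_real (h' - h) * v - cnj (g' - g) * u"
    using 0 e by (simp, algebra)
  then have 2: "2 * cmod v \<le> \<bar>h' - h\<bar> * cmod v + cmod (g' - g) * cmod u"
    by (metis complex_mod_cnj norm_minus_cancel norm_mult norm_numeral norm_of_real norm_triangle_ineq4)
  have "\<bar>h' - h\<bar> * cmod u \<le> 1/2 * cmod u" "\<bar>h' - h\<bar> * cmod v \<le> 1/2 * cmod v"
    "cmod (g' - g) * cmod u \<le> 1/2 * cmod u" "cmod (g' - g) * cmod v \<le> 1/2 * cmod v"
    by (intro mult_right_mono less_imp_le assms(3,4) norm_ge_zero)+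
  then have "cmod u + cmod v \<le> 0" using 1 2 by linarith
  then show False using assms(2)
    by (metis add_nonneg_eq_0_iff antisym norm_eq_zero norm_ge_zero add_nonneg_nonneg)
qed

text \<open>The lift is extended over time steps so short that, by uniform continuity,
  \<open>g\<close> and \<open>h\<close> change by less than 1/2. In each step the lift at the left
  end is projected onto the current eigenline, where it stays nonzero.\<close>

lemma eigenpair_lift:
  fixes g :: "'a::metric_space \<times> real \<Rightarrow> complex" and h :: "'a \<times> real \<Rightarrow> real"
  assumes X: "compact X"
    and g: "continuous_on (X \<times> {0..1}) g" and h: "continuous_on (X \<times> {0..1}) h"
    and unit: "\<And>p. p \<in> X \<times> {0..1} \<Longrightarrow> (cmod (g p))\<^sup>2 + (h p)\<^sup>2 = 1"
    and start: "\<And>y. y \<in> X \<Longrightarrow> h (y, 0) \<noteq> -1"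
  obtains u v :: "'a \<times> real \<Rightarrow> complex" where
    "continuous_on (X \<times> {0..1}) u" "continuous_on (X \<times> {0..1}) v"
    "\<And>p. p \<in> X \<times> {0..1} \<Longrightarrow> eigenpair (g p) (h p) (u p) (v p)"
    "\<And>p. p \<in> X \<times> {0..1} \<Longrightarrow> u p \<noteq> 0 \<or> v p \<noteq> 0"
    "\<And>y. y \<in> X \<Longrightarrow> u (y, 0) = g (y, 0) \<and> v (y, 0) = 1 + of_real (h (y, 0))"
proof -
  define good where "good t u v \<longleftrightarrow>
    continuous_on (X \<times> {0..t}) u \<and> continuous_on (X \<times> {0..t}) v \<and>
    (\<forall>p \<in> X \<times> {0..t}. eigenpair (g p) (h p) (u p) (v p) \<and> (u p \<noteq> 0 \<or> v p \<noteq> 0)) \<and>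
    (\<forall>y\<in>X. u (y, 0) = g (y, 0) \<and> v (y, 0) = 1 + of_real (h (y, 0)))"
    for t and u v :: "'a \<times> real \<Rightarrow> complex"
  have comp: "compact (X \<times> {0..1::real})" using X by (intro compact_Times) auto
  obtain d1 where d1: "d1 > 0" "\<And>p p'. p \<in> X \<times> {0..1} \<Longrightarrow> p' \<in> X \<times> {0..1} \<Longrightarrow> dist p' p < d1
      \<Longrightarrow> dist (g p') (g p) < 1/2"
    using compact_uniformly_continuous[OF g comp] unfolding uniformly_continuous_on_def
    by (metis half_gt_zero_iff zero_less_one)
  obtain d2 where d2: "d2 > 0" "\<And>p p'. p \<in> X \<times> {0..1} \<Longrightarrow> p' \<in> X \<times> {0..1} \<Longrightarrow> dist p' p < d2
      \<Longrightarrow> dist (h p') (h p) < 1/2"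
    using compact_uniformly_continuous[OF h comp] unfolding uniformly_continuous_on_def
    by (metis half_gt_zero_iff zero_less_one)
  obtain n :: nat where n: "n > 0" "1 / n < min d1 d2"
    using d1(1) d2(1) by (metis min_less_iff_conj nat_approx_posE zero_less_Suc)
  have "\<exists>u v. good (k / n) u v" if "k \<le> n" for k
    using that
  proof (induction k)
    case 0
    have "(cmod (g (y, 0)))\<^sup>2 + (h (y, 0))\<^sup>2 = 1" if "y \<in> X" for y
      using unit that by auto
    moreover have start': "1 + complex_of_real (h (y, 0)) \<noteq> 0" if "y \<in> X" for y
      using start[OF that] by (metis add_eq_0_iff of_real_eq_1_iff of_real_minus minus_minus)
    \<comment> \<open>The initial lift is the projection of the constant vector
      \<open>(0, 1)\<close>; it is nonzero since \<open>h \<noteq> -1\<close>.\<close>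
    ultimately have "eigenpair (g (y, 0)) (h (y, 0)) (g (y, 0)) (1 + of_real (h (y, 0)))" if "y \<in> X" for y
      using eigenpair_projection[of "g (y, 0)" "h (y, 0)" 0 1] that by simp
    moreover have "continuous_on (X \<times> {0..0}) g" "continuous_on (X \<times> {0..0}) (\<lambda>p. 1 + complex_of_real (h p))"
      by (intro continuous_intros continuous_on_subset[OF g] continuous_on_subset[OF h]; force)+
    ultimately have "good 0 g (\<lambda>p. 1 + of_real (h p))"
      using start' unfolding good_def by auto
    then show ?case by auto
  next
    case (Suc k)
    then obtain u v where uv: "good (k / n) u v" by auto
    define s0 where "s0 = k / n"
    define s1 where "s1 = Suc k / n"
    have s: "0 \<le> s0" "s0 \<le> s1" "s1 \<le> 1" "s1 - s0 < min d1 d2"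
      using Suc.prems n by (auto simp: s0_def s1_def field_simps)
    define u' where "u' p = (1 - of_real (h p)) * u (fst p, s0) + g p * v (fst p, s0)" for p
    define v' where "v' p = cnj (g p) * u (fst p, s0) + (1 + of_real (h p)) * v (fst p, s0)" for p
    \<comment> \<open>On an eigenvector the projection acts as multiplication by 2. Halving it
      therefore makes the old and the new piece agree at \<open>s0\<close>.\<close>
    define U where "U p = (if snd p \<le> s0 then u p else u' p / 2)" for p
    define V where "V p = (if snd p \<le> s0 then v p else v' p / 2)" for p
    note uv = uv[folded s0_def, unfolded good_def]
    have agree: "u' (y, s0) / 2 = u (y, s0)" "v' (y, s0) / 2 = v (y, s0)" if "y \<in> X" for y
    proof -
      have "eigenpair (g (y,s0)) (h (y,s0)) (u (y,s0)) (v (y,s0))"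
        using uv that s by auto
      then show "u' (y, s0) / 2 = u (y, s0)" "v' (y, s0) / 2 = v (y, s0)"
        unfolding u'_def v'_def eigenpair_def by (auto simp: algebra_simps)
    qed
    have c0: "continuous_on (X \<times> {s0..s1}) (\<lambda>p. u (fst p, s0))"
      by (rule continuous_on_compose2[of "X \<times> {0..s0}" u]) (use uv s in \<open>auto intro!: continuous_intros\<close>)
    have c1: "continuous_on (X \<times> {s0..s1}) (\<lambda>p. v (fst p, s0))"
      by (rule continuous_on_compose2[of "X \<times> {0..s0}" v]) (use uv s in \<open>auto intro!: continuous_intros\<close>)
    have cu: "continuous_on (X \<times> {s0..s1}) u'" "continuous_on (X \<times> {s0..s1}) v'"
      unfolding u'_def v'_def using s
      by (intro continuous_intros c0 c1 continuous_on_subset[OF g] continuous_on_subset[OF h]; force)+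
    have un: "X \<times> {0..s1} = X \<times> {0..s0} \<union> X \<times> {s0..s1}" using s by auto
    have cl: "closedin (top_of_set (X \<times> {0..s1})) (X \<times> {0..s0})" "closedin (top_of_set (X \<times> {0..s1})) (X \<times> {s0..s1})"
      using s by (intro closedin_Times closedin_subtopology_refl[THEN iffD2] closed_subset; simp)+
    have "continuous_on (X \<times> {0..s1}) U" unfolding U_def un
      by (rule continuous_on_cases_local) (use cl uv cu agree in \<open>auto simp flip: un intro!: continuous_intros\<close>)
    moreover have "continuous_on (X \<times> {0..s1}) V" unfolding V_def un
      by (rule continuous_on_cases_local) (use cl uv cu agree in \<open>auto simp flip: un intro!: continuous_intros\<close>)
    moreover have "eigenpair (g p) (h p) (U p) (V p) \<and> (U p \<noteq> 0 \<or> V p \<noteq> 0)"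
      if p: "p \<in> X \<times> {0..s1}" for p
    proof (cases "snd p \<le> s0")
      case True
      then show ?thesis using uv p by (auto simp: U_def V_def)
    next
      case False
      obtain y t where yt: "p = (y, t)" "y \<in> X" "s0 < t" "t \<le> s1" using False p by auto
      have e0: "eigenpair (g (y, s0)) (h (y, s0)) (u (y, s0)) (v (y, s0))"
        "u (y, s0) \<noteq> 0 \<or> v (y, s0) \<noteq> 0"
        using uv yt s by auto
      have "dist p (y, s0) < min d1 d2" using yt s by (simp add: dist_Pair_Pair dist_real_def)
      then have "cmod (g p - g (y, s0)) < 1/2" "\<bar>h p - h (y, s0)\<bar> < 1/2"
        using d1(2)[of "(y, s0)" p] d2(2)[of "(y, s0)" p] yt s by (auto simp: dist_norm)
      from eigenpair_projection_nonzero[OF e0 this]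
      have "u' p \<noteq> 0 \<or> v' p \<noteq> 0" unfolding u'_def v'_def yt by simp
      moreover have "eigenpair (g p) (h p) (u' p) (v' p)"
        unfolding u'_def v'_def by (rule eigenpair_projection) (use unit yt s in auto)
      ultimately show ?thesis using False by (auto simp: U_def V_def eigenpair_def)
    qed
    moreover have "\<forall>y\<in>X. U (y, 0) = g (y, 0) \<and> V (y, 0) = 1 + of_real (h (y, 0))"
      using uv s by (auto simp: U_def V_def)
    ultimately have "good s1 U V" unfolding good_def by blast
    then show ?case unfolding s1_def by blast
  qed
  from this[of n] obtain u v where "good 1 u v" using n by auto
  then show ?thesis unfolding good_def using that by blast
qed

text \<open>At \<open>s = 0\<close> the lift \<open>(G, 1 + H)\<close> changes under
  \<open>J\<close> only by the sign of its first entry, so \<open>q = 1\<close>. At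
  \<open>s = 1\<close> the first entry \<open>u\<close> has no zero, and \<open>q\<close> is minus
  the quotient of its values at \<open>J y\<close> and \<open>y\<close>. Logarithms of this quotient
  telescope along an orbit, and the four minus signs leave \<open>4\<pi>i\<close> up to multiples of
  \<open>8\<pi>i\<close>. By connectedness both orbit sums would have to agree.\<close>

lemma quarter_turn_obstruction:
  fixes X :: "'a::real_normed_vector set" and J :: "'a \<Rightarrow> 'a"
    and g :: "'a \<times> real \<Rightarrow> complex" and h :: "'a \<times> real \<Rightarrow> real"
  assumes X: "compact X" "X \<noteq> {}" "simply_connected X" "locally path_connected X"
    and J: "continuous_on X J" "\<And>y. y \<in> X \<Longrightarrow> J y \<in> X" "\<And>y. y \<in> X \<Longrightarrow> J (J (J (J y))) = y"
    and g: "continuous_on (X \<times> {0..1}) g" and h: "continuous_on (X \<times> {0..1}) h"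
    and odd: "\<And>y s. y \<in> X \<Longrightarrow> s \<in> {0..1} \<Longrightarrow> g (J y, s) = - g (y, s)"
    and even: "\<And>y s. y \<in> X \<Longrightarrow> s \<in> {0..1} \<Longrightarrow> h (J y, s) = h (y, s)"
    and nz: "\<And>p. p \<in> X \<times> {0..1} \<Longrightarrow> g p = 0 \<Longrightarrow> h p \<noteq> 0"
    and start: "\<And>y. y \<in> X \<Longrightarrow> g (y, 0) = 0 \<Longrightarrow> h (y, 0) > 0"
    and finish: "\<And>y. y \<in> X \<Longrightarrow> g (y, 1) = 0 \<Longrightarrow> h (y, 1) < 0"
  shows False
proof -
  define r where "r p = sqrt ((cmod (g p))\<^sup>2 + (h p)\<^sup>2)" for p
  have r: "r p > 0" if "p \<in> X \<times> {0..1}" for p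
    using nz[OF that] by (auto simp: r_def add_nonneg_pos add_pos_nonneg sum_power2_gt_zero_iff)
  define G where "G p = g p / of_real (r p)" for p
  define H where "H p = h p / r p" for p
  have cr: "continuous_on (X \<times> {0..1}) r" unfolding r_def by (intro continuous_intros g h)
  have G: "continuous_on (X \<times> {0..1}) G" unfolding G_def
    by (intro continuous_intros g cr) (use r in force)
  have H: "continuous_on (X \<times> {0..1}) H" unfolding H_def
    by (intro continuous_intros h cr) (use r in force)
  have unit: "(cmod (G p))\<^sup>2 + (H p)\<^sup>2 = 1" if "p \<in> X \<times> {0..1}" for p
  proof -
    have "(r p)\<^sup>2 = (cmod (g p))\<^sup>2 + (h p)\<^sup>2" by (simp add: r_def)
    then show ?thesis using r[OF that] nz[OF that]
      by (simp add: G_def H_def norm_divide power_divide flip: add_divide_distrib)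
  qed
  have r_even: "r (J y, s) = r (y, s)" if "y \<in> X" "s \<in> {0..1}" for y s
    using odd[OF that] even[OF that] by (simp add: r_def)
  have GJ: "G (J y, s) = - G (y, s)" "H (J y, s) = H (y, s)" if "y \<in> X" "s \<in> {0..1}" for y s
    using odd[OF that] even[OF that] r_even[OF that] by (simp_all add: G_def H_def)
  have H0: "H (y, 0) \<noteq> -1" if "y \<in> X" for y
  proof
    assume "H (y, 0) = -1"
    moreover from this have "G (y, 0) = 0" using unit[of "(y, 0)"] that by simp
    ultimately show False using start[OF that] r[of "(y, 0)"] that by (auto simp: G_def H_def field_simps)
  qed
  \<comment> \<open>Avoiding this pole at \<open>s = 1\<close> is what later keeps \<open>u\<close>
    away from zero there: \<open>u = 0\<close> would force \<open>(1 - H) * v = 0\<close> with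
    \<open>v \<noteq> 0\<close>.\<close>
  have H1: "H (y, 1) \<noteq> 1" if "y \<in> X" for y
  proof
    assume "H (y, 1) = 1"
    moreover from this have "G (y, 1) = 0" using unit[of "(y, 1)"] that by simp
    ultimately show False using finish[OF that] r[of "(y, 1)"] that by (auto simp: G_def H_def field_simps)
  qed
  obtain u v where u: "continuous_on (X \<times> {0..1}) u" and v: "continuous_on (X \<times> {0..1}) v"
    and eig: "\<And>p. p \<in> X \<times> {0..1} \<Longrightarrow> eigenpair (G p) (H p) (u p) (v p)"
    and uv0: "\<And>p. p \<in> X \<times> {0..1} \<Longrightarrow> u p \<noteq> 0 \<or> v p \<noteq> 0"
    and uv_start: "\<And>y. y \<in> X \<Longrightarrow> u (y, 0) = G (y, 0) \<and> v (y, 0) = 1 + of_real (H (y, 0))"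
    using eigenpair_lift[OF X(1) G H unit H0] by blast
  define m where "m p = u p * cnj (u p) + v p * cnj (v p)" for p
  have m0: "m p \<noteq> 0" if "p \<in> X \<times> {0..1}" for p
  proof -
    have "m p = of_real ((cmod (u p))\<^sup>2 + (cmod (v p))\<^sup>2)"
      by (simp only: m_def of_real_add complex_norm_square)
    moreover have "(cmod (u p))\<^sup>2 + (cmod (v p))\<^sup>2 \<noteq> 0"
      using uv0[OF that] by (simp add: sum_power2_eq_zero_iff)
    ultimately show ?thesis by (metis of_real_eq_0_iff)
  qed
  text \<open>\<open>(-u, v)\<close> at \<open>(y, s)\<close> and \<open>(u, v)\<close> at \<open>(J y, s)\<close> span the same line; \<open>q\<close> is their
    ratio.\<close>
  define q where "q p = (v (J (fst p), snd p) * cnj (v p) - u (J (fst p), snd p) * cnj (u p)) / m p" for p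
  have cJ: "continuous_on (X \<times> {0..1::real}) (\<lambda>p. w (J (fst p), snd p))"
    if "continuous_on (X \<times> {0..1}) w" for w :: "'a \<times> real \<Rightarrow> complex"
    by (rule continuous_on_compose2[OF that])
      (use J in \<open>auto intro!: continuous_intros continuous_on_compose2[OF J(1)]\<close>)
  have q: "continuous_on (X \<times> {0..1}) q"
    unfolding q_def using m0 by (intro continuous_intros cJ u v) (auto simp: m_def intro!: continuous_intros u v)
  have q_eq: "u (J y, s) = - q (y, s) * u (y, s)" "v (J y, s) = q (y, s) * v (y, s)"
    if "y \<in> X" "s \<in> {0..1}" for y s
  proof -
    have e: "(1 + of_real (H (y,s))) * u (y,s) = G (y,s) * v (y,s)"
      "cnj (G (y,s)) * u (y,s) = (1 - of_real (H (y,s))) * v (y,s)"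
      using eig[of "(y, s)"] that by (auto simp: eigenpair_def)
    have e': "(1 + of_real (H (y,s))) * u (J y,s) = - G (y,s) * v (J y,s)"
      "- cnj (G (y,s)) * u (J y,s) = (1 - of_real (H (y,s))) * v (J y,s)"
      using eig[of "(J y, s)"] GJ[OF that] J(2) that by (auto simp: eigenpair_def)
    \<comment> \<open>The two eigenvector equations give this identity with the factors
      \<open>1 + H\<close> and \<open>1 - H\<close> in place of 2. Either factor may vanish, but
      their sum is 2.\<close>
    have "2 * (u (J y, s) * v (y, s)) = - (2 * (u (y, s) * v (J y, s)))"
      using e e' by algebra
    then have cross: "u (J y, s) * v (y, s) = - u (y, s) * v (J y, s)" by (simp add: mult_ac)
    have "m (y, s) \<noteq> 0" using m0 that by auto
    then have qm: "q (y, s) * m (y, s) = v (J y, s) * cnj (v (y, s)) - u (J y, s) * cnj (u (y, s))"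
      by (simp add: q_def)
    have "m (y, s) * u (J y, s) = m (y, s) * (- q (y, s) * u (y, s))"
      using qm cross unfolding m_def by algebra
    then show "u (J y, s) = - q (y, s) * u (y, s)" using \<open>m (y, s) \<noteq> 0\<close> mult_left_cancel by blast
    have "m (y, s) * v (J y, s) = m (y, s) * (q (y, s) * v (y, s))"
      using qm cross unfolding m_def by algebra
    then show "v (J y, s) = q (y, s) * v (y, s)" using \<open>m (y, s) \<noteq> 0\<close> mult_left_cancel by blast
  qed
  have q0: "q p \<noteq> 0" if p: "p \<in> X \<times> {0..1}" for p
  proof
    assume "q p = 0"
    obtain y s where "p = (y, s)" "y \<in> X" "s \<in> {0..1}" using p by auto
    with \<open>q p = 0\<close> show False using q_eq[of y s] uv0[of "(J y, s)"] J(2) by auto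
  qed
  have sc: "simply_connected (X \<times> {0..1::real})"
    using X(3) by (intro simply_connected_Times) (auto intro: convex_imp_simply_connected)
  have lpc: "locally path_connected (X \<times> {0..1::real})"
    by (rule locally_Times[OF X(4)])
      (auto intro: path_connected_Times convex_imp_locally_path_connected)
  obtain \<theta> where \<theta>: "continuous_on (X \<times> {0..1}) \<theta>" "\<And>p. p \<in> X \<times> {0..1} \<Longrightarrow> q p = exp (\<theta> p)"
    using continuous_logarithm_on_simply_connected[OF q sc lpc q0] by blast
  have conX: "connected X" using X(3) by (simp add: simply_connected_imp_connected)
  have slice: "continuous_on X (\<lambda>y. w (y, s))" if "continuous_on (X \<times> {0..1}) w" "s \<in> {0..1}"
    for w :: "'a \<times> real \<Rightarrow> complex" and s
    by (rule continuous_on_compose2[OF that(1)]) (use that(2) in \<open>auto intro!: continuous_intros\<close>)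
  have "exp (\<theta> (y, 0)) = 1" if y: "y \<in> X" for y
  proof -
    have "1 + complex_of_real (H (y, 0)) \<noteq> 0"
      using H0[OF y] by (metis add_eq_0_iff of_real_eq_1_iff of_real_minus minus_minus)
    then have "q (y, 0) = 1"
      using q_eq(2)[of y 0] uv_start[OF y] uv_start[OF J(2)[OF y]] GJ(2)[of y 0] y by simp
    then show ?thesis using \<theta>(2)[of "(y, 0)"] y by simp
  qed
  then obtain l :: int where l: "\<And>y. y \<in> X \<Longrightarrow> \<theta> (y, 0) = 2 * of_int l * of_real pi * \<i>"
    using exp_eq_1_imp_constant[OF conX slice[OF \<theta>(1), of 0]] by auto
  have u1: "u (y, 1) \<noteq> 0" if y: "y \<in> X" for y
  proof
    assume "u (y, 1) = 0"
    moreover have "eigenpair (G (y,1)) (H (y,1)) (u (y,1)) (v (y,1))" "u (y,1) \<noteq> 0 \<or> v (y,1) \<noteq> 0"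
      using eig[of "(y, 1)"] uv0[of "(y, 1)"] y by auto
    ultimately have "1 - complex_of_real (H (y, 1)) = 0" by (simp add: eigenpair_def)
    then show False using H1[OF y] by (metis eq_iff_diff_eq_0 of_real_eq_1_iff)
  qed
  have "continuous_on X (\<lambda>y. u (y, 1))" by (rule slice[OF u]) auto
  then obtain \<eta> where \<eta>: "continuous_on X \<eta>" "\<And>y. y \<in> X \<Longrightarrow> u (y, 1) = exp (\<eta> y)"
    using continuous_logarithm_on_simply_connected[OF _ X(3,4)] u1 by blast
  \<comment> \<open>Two logarithms of \<open>q (y, 1)\<close> are compared: \<open>\<theta>\<close>,
    and the one obtained from \<open>\<eta>\<close>, in which \<open>\<pi>i\<close> accounts for the
    minus sign in the rule for \<open>u\<close>.\<close>
  define w where "w y = \<theta> (y, 1) - (\<eta> (J y) - \<eta> y + of_real pi * \<i>)" for y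
  have "exp (w y) = 1" if y: "y \<in> X" for y
  proof -
    have "exp (w y) = exp (\<theta> (y, 1)) / (exp (\<eta> (J y)) / exp (\<eta> y) * -1)"
      unfolding w_def exp_diff exp_add by simp
    also have "\<dots> = q (y, 1) / (u (J y, 1) / u (y, 1) * -1)"
      using \<theta>(2)[of "(y, 1)"] \<eta>(2)[OF y] \<eta>(2)[OF J(2)[OF y]] y by simp
    also have "\<dots> = 1" using q_eq(1)[of y 1] u1[OF y] u1[OF J(2)[OF y]] y by (simp add: divide_simps)
    finally show ?thesis .
  qed
  moreover have "continuous_on X w" unfolding w_def
    by (intro continuous_intros slice[OF \<theta>(1)] \<eta>(1) continuous_on_compose2[OF \<eta>(1) J(1)]) (use J in auto)
  ultimately obtain k :: int where k: "\<And>y. y \<in> X \<Longrightarrow> w y = 2 * of_int k * of_real pi * \<i>"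
    using exp_eq_1_imp_constant[OF conX] by blast
  text \<open>The product of \<open>q\<close> along an orbit of \<open>J\<close> is \<open>1\<close>, so this sum is a constant; at the two
    ends of the unit interval it is computed from \<open>l\<close> and from \<open>k\<close>.\<close>
  define T where "T p = \<theta> p + \<theta> (J (fst p), snd p) + \<theta> (J (J (fst p)), snd p) + \<theta> (J (J (J (fst p))), snd p)" for p
  have "continuous_on (X \<times> {0..1}) T" unfolding T_def
  proof (intro continuous_intros \<theta>(1) cJ[OF \<theta>(1)])
    have 2: "continuous_on (X \<times> {0..1}) (\<lambda>p. \<theta> (J (J (fst p)), snd p))"
      using cJ[OF cJ[OF \<theta>(1)]] by simp
    show "continuous_on (X \<times> {0..1}) (\<lambda>p. \<theta> (J (J (fst p)), snd p))" by (rule 2)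
    show "continuous_on (X \<times> {0..1}) (\<lambda>p. \<theta> (J (J (J (fst p))), snd p))" using cJ[OF 2] by simp
  qed
  moreover have "exp (T p) = 1" if p: "p \<in> X \<times> {0..1}" for p
  proof -
    obtain y s where ys: "p = (y, s)" "y \<in> X" "s \<in> {0..1}" using p by auto
    have J': "J y \<in> X" "J (J y) \<in> X" "J (J (J y)) \<in> X" using J(2) ys by auto
    \<comment> \<open>The four minus signs in the rule for \<open>u\<close> cancel and four turns
      return to \<open>y\<close>, so multiplication by \<open>Q\<close> fixes the nonzero vector
      \<open>(u, v)\<close>.\<close>
    define Q where "Q = q (J (J (J y)), s) * q (J (J y), s) * q (J y, s) * q (y, s)"
    have "u (y, s) = Q * u (y, s)" "v (y, s) = Q * v (y, s)"
      using q_eq[OF ys(2,3)] q_eq[OF J'(1) ys(3)] q_eq[OF J'(2) ys(3)] q_eq[OF J'(3) ys(3)] J(3)[OF ys(2)]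
      unfolding Q_def by (auto simp: algebra_simps)
    then have "Q = 1" using uv0[OF p] ys by auto
    then show ?thesis unfolding T_def exp_add using \<theta>(2) J' ys by (simp add: Q_def mult_ac)
  qed
  moreover have "connected (X \<times> {0..1::real})" by (rule simply_connected_imp_connected[OF sc])
  ultimately obtain j :: int where j: "\<And>p. p \<in> X \<times> {0..1} \<Longrightarrow> T p = 2 * of_int j * of_real pi * \<i>"
    using exp_eq_1_imp_constant by metis
  obtain y where y: "y \<in> X" using X(2) by auto
  have J': "J y \<in> X" "J (J y) \<in> X" "J (J (J y)) \<in> X" using J(2) y by auto
  have "T (y, 0) = T (y, 1)" using j y by auto
  moreover have "T (y, 0) = 8 * of_int l * of_real pi * \<i>"
    using l y J' by (simp add: T_def)
  moreover have "T (y, 1) = 4 * of_real pi * \<i> + 8 * of_int k * of_real pi * \<i>"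
  proof -
    have "\<theta> (x, 1) = \<eta> (J x) - \<eta> x + of_real pi * \<i> + 2 * of_int k * of_real pi * \<i>" if "x \<in> X" for x
      using k[OF that] unfolding w_def by (simp add: algebra_simps)
    then show ?thesis using y J' J(3)[OF y] unfolding T_def by simp
  qed
  ultimately have "(8 * complex_of_int l) * (pi * \<i>) = (4 + 8 * of_int k) * (pi * \<i>)"
    by (simp add: algebra_simps)
  then have "8 * complex_of_int l = 4 + 8 * of_int k" by (simp add: mult_right_cancel)
  then have "complex_of_int (8 * l) = complex_of_int (4 + 8 * k)" by simp
  then have "8 * l = 4 + 8 * k" by (simp only: of_int_eq_iff)
  then show False by presburger
qed

subsection \<open>Radial projection and the space of pairs\<close>

text \<open>The choice of the parameter is immaterial for \<open>c\<close> in the interior of a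
  compact convex \<open>B\<close> and \<open>w \<noteq> 0\<close>, where it is unique. For
  \<open>w = 0\<close> the value is \<open>c\<close>.\<close>

definition ray_point :: "'a::euclidean_space set \<Rightarrow> 'a \<Rightarrow> 'a \<Rightarrow> 'a" where
  "ray_point B c w = c + (SOME t. 0 < t \<and> c + t *\<^sub>R w \<in> frontier B) *\<^sub>R w"

context
  fixes B :: "'a::euclidean_space set" and c :: 'a
  assumes B: "convex B" "compact B" and c: "c \<in> interior B"
begin

text \<open>Of two frontier points on one ray from \<open>c\<close>, the nearer would lie on the
  open segment from the interior point \<open>c\<close> to the farther, hence in the
  interior.\<close>

lemma ray_unique:
  assumes "0 < t" "0 < t'" "c + t *\<^sub>R w \<in> frontier B" "c + t' *\<^sub>R w \<in> frontier B" "w \<noteq> 0"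
  shows "t = t'"
proof -
  have "\<not> s < s'" if "0 < s" "c + s *\<^sub>R w \<in> frontier B" "c + s' *\<^sub>R w \<in> frontier B" for s s'
  proof
    assume "s < s'"
    have "c + s *\<^sub>R w \<in> open_segment c (c + s' *\<^sub>R w)"
      unfolding in_segment
    proof (intro conjI exI)
      show "c + s *\<^sub>R w = (1 - s / s') *\<^sub>R c + (s / s') *\<^sub>R (c + s' *\<^sub>R w)"
        using that \<open>s < s'\<close> by (simp add: algebra_simps)
    qed (use that \<open>s < s'\<close> assms(5) in auto)
    moreover have "open_segment c (c + s' *\<^sub>R w) \<subseteq> interior B"
      using in_interior_closure_convex_segment[OF B(1) c] that(3) by (auto simp: frontier_def)
    ultimately show False using that(2) by (auto simp: frontier_def)
  qed
  from this[of t t'] this[of t' t] show ?thesis using assms by force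
qed

lemma ray_point:
  assumes "w \<noteq> 0"
  obtains t where "0 < t" "ray_point B c w = c + t *\<^sub>R w" "ray_point B c w \<in> frontier B"
proof -
  obtain d where "0 < d" "c + d *\<^sub>R w \<in> frontier B"
    using ray_to_frontier[OF compact_imp_bounded[OF B(2)] c assms] by metis
  then have "\<exists>t. 0 < t \<and> c + t *\<^sub>R w \<in> frontier B" by blast
  from someI_ex[OF this] show ?thesis using that unfolding ray_point_def by blast
qed

lemma ray_point_eqI:
  assumes "0 < t" "c + t *\<^sub>R w \<in> frontier B" "w \<noteq> 0"
  shows "ray_point B c w = c + t *\<^sub>R w"
  by (metis assms ray_point ray_unique)

lemma ray_point_frontier:
  assumes "x \<in> frontier B"
  shows "ray_point B c (x - c) = x"
proof -
  have "x \<noteq> c" using assms c by (auto simp: frontier_def)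
  then show ?thesis using ray_point_eqI[of 1 "x - c"] assms by simp
qed

text \<open>After translating \<open>c\<close> to the origin this is the radial projection onto a
  compact surface that every ray meets exactly once.\<close>

lemma continuous_on_ray_point: "continuous_on (- {0}) (ray_point B c)"
proof -
  define d where "d w = (SOME t. 0 < t \<and> c + t *\<^sub>R w \<in> frontier B)" for w
  have "continuous_on (UNIV - {0}) (\<lambda>w. d w *\<^sub>R w)"
  proof (rule continuous_on_compact_surface_projection)
    show "compact ((\<lambda>x. - c + x) ` frontier B)"
      by (intro compact_translation compact_frontier B)
    show "(\<lambda>x. - c + x) ` frontier B \<subseteq> UNIV - {0}" using c by (auto simp: frontier_def)
    show "cone (UNIV :: 'a set)" by (simp add: cone_univ)
    fix w :: 'a and k :: real
    assume w: "w \<in> UNIV - {0}"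
    obtain t where t: "0 < t" "c + t *\<^sub>R w \<in> frontier B" "ray_point B c w = c + t *\<^sub>R w"
      using ray_point w by (metis DiffE singletonI)
    have "d w = t" using t(3) w by (simp add: ray_point_def d_def)
    moreover have "k *\<^sub>R w \<in> (\<lambda>x. - c + x) ` frontier B \<longleftrightarrow> c + k *\<^sub>R w \<in> frontier B"
      by (force simp: image_iff algebra_simps)
    ultimately show "(0 < k \<and> k *\<^sub>R w \<in> (\<lambda>x. - c + x) ` frontier B) \<longleftrightarrow> d w = k"
      using t ray_unique w by auto
  qed
  then have "continuous_on (- {0}) (\<lambda>w. c + d w *\<^sub>R w)"
    unfolding Compl_eq_Diff_UNIV by (rule continuous_on_add[OF continuous_on_const])
  then show ?thesis by (simp add: ray_point_def d_def)
qed

lemma ray_point_minus_neq: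
  assumes "w \<noteq> 0"
  shows "ray_point B c (- w) \<noteq> ray_point B c w"
proof -
  obtain t where t: "0 < t" "ray_point B c w = c + t *\<^sub>R w"
    using ray_point[OF assms] .
  obtain t' where t': "0 < t'" "ray_point B c (- w) = c + t' *\<^sub>R (- w)"
    using ray_point[of "- w"] assms by auto
  have "(t + t') *\<^sub>R w \<noteq> 0" using t t' assms by simp
  then show ?thesis unfolding t(2) t'(2) by (auto simp: algebra_simps)
qed

text \<open>The line through \<open>c\<close> with direction \<open>w\<close> consists of two
  opposite rays and the interior point \<open>c\<close>; each ray contributes exactly one frontier
  point.\<close>

lemma opposite_ray_point:
  assumes w: "w \<noteq> 0"
  shows "opposite B c (ray_point B c w) = ray_point B c (- w)"
proof -
  obtain t where t: "0 < t" "ray_point B c w = c + t *\<^sub>R w" "ray_point B c w \<in> frontier B"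
    using ray_point[OF w] .
  obtain t' where t': "0 < t'" "ray_point B c (- w) = c + t' *\<^sub>R (- w)" "ray_point B c (- w) \<in> frontier B"
    using ray_point[of "- w"] w by auto
  have "affine hull {c, c + t *\<^sub>R w} = {c + s *\<^sub>R w | s. True}"
  proof -
    have "u *\<^sub>R c + v *\<^sub>R (c + t *\<^sub>R w) = c + (v * t) *\<^sub>R w" if "u + v = 1" for u v :: real
    proof -
      have "u *\<^sub>R c + v *\<^sub>R (c + t *\<^sub>R w) = (u + v) *\<^sub>R c + (v * t) *\<^sub>R w"
        by (simp add: algebra_simps)
      then show ?thesis using that by simp
    qed
    moreover have "\<exists>u v. c + s *\<^sub>R w = u *\<^sub>R c + v *\<^sub>R (c + t *\<^sub>R w) \<and> u + v = 1" for s
      using t(1) by (intro exI[of _ "1 - s / t"] exI[of _ "s / t"]) (simp add: algebra_simps)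
    ultimately show ?thesis unfolding affine_hull_2 by blast
  qed
  moreover have "{c + s *\<^sub>R w | s. True} \<inter> frontier B = {c + t *\<^sub>R w, c + t' *\<^sub>R (- w)}"
  proof (intro equalityI subsetI)
    fix x assume "x \<in> {c + s *\<^sub>R w | s. True} \<inter> frontier B"
    then obtain s where s: "x = c + s *\<^sub>R w" "x \<in> frontier B" by auto
    have "s \<noteq> 0" using s c by (auto simp: frontier_def)
    then consider "s > 0" | "- s > 0" by linarith
    then show "x \<in> {c + t *\<^sub>R w, c + t' *\<^sub>R (- w)}"
    proof cases
      case 1
      then show ?thesis using ray_unique[of s t w] s t w by auto
    next
      case 2
      have "c + (- s) *\<^sub>R (- w) \<in> frontier B" using s by simp
      then show ?thesis using ray_unique[of "- s" t' "- w"] s t' w 2 by auto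
    qed
  next
    fix x assume "x \<in> {c + t *\<^sub>R w, c + t' *\<^sub>R (- w)}"
    moreover have "c + t' *\<^sub>R (- w) = c + (- t') *\<^sub>R w" by simp
    ultimately have "\<exists>s. x = c + s *\<^sub>R w" by (metis insertE singletonD)
    moreover have "x \<in> frontier B"
      using \<open>x \<in> {c + t *\<^sub>R w, c + t' *\<^sub>R (- w)}\<close> t t' by auto
    ultimately show "x \<in> {c + s *\<^sub>R w | s. True} \<inter> frontier B" by blast
  qed
  ultimately have eq: "affine hull {c, ray_point B c w} \<inter> frontier B = {ray_point B c w, ray_point B c (- w)}"
    using t(2) t'(2) by simp
  with ray_point_minus_neq[OF w] show ?thesis unfolding opposite_def
    by (intro the_equality) (auto simp: doubleton_eq_iff)
qed

lemma antipodal_ray_point: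
  assumes w: "w \<noteq> 0"
  shows "antipodal B c (ray_point B c w) (ray_point B c (- w))"
  using opposite_ray_point[of "- w"] w ray_point[OF w] ray_point[of "- w"]
  unfolding antipodal_def by (metis minus_minus neg_equal_0_iff_equal)

lemma not_antipodal_self: "\<not> antipodal B c a a"
proof
  assume a: "antipodal B c a a"
  then have fr: "a \<in> frontier B" by (simp add: antipodal_def)
  then have "a - c \<noteq> 0" using c by (auto simp: frontier_def)
  then show False
    using a ray_point_frontier[OF fr] opposite_ray_point ray_point_minus_neq
    by (metis antipodal_def)
qed

end

section \<open>Orthonormal pairs from unit quaternions\<close>

text \<open>The images of \<open>i\<close> and of \<open>j\<close> under conjugation with the quaternion \<open>\<alpha> + \<beta>j\<close>, for
  \<open>y = (\<alpha>, \<beta>)\<close>. Right multiplication by \<open>j\<close>, that is, \<open>(\<alpha>, \<beta>) \<mapsto> (-\<beta>, \<alpha>)\<close>, reverses the first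
  and fixes the second.\<close>

definition quat_i :: "complex \<times> complex \<Rightarrow> real^3" where
  "quat_i y = (let a = Re (fst y); b = Im (fst y); c = Re (snd y); d = Im (snd y) in
     (a\<^sup>2 + b\<^sup>2 - c\<^sup>2 - d\<^sup>2) *\<^sub>R axis 1 1 + (2 * (a * d + b * c)) *\<^sub>R axis 2 1 +
     (2 * (b * d - a * c)) *\<^sub>R axis 3 1)"

definition quat_j :: "complex \<times> complex \<Rightarrow> real^3" where
  "quat_j y = (let a = Re (fst y); b = Im (fst y); c = Re (snd y); d = Im (snd y) in
     (2 * (b * c - a * d)) *\<^sub>R axis 1 1 + (a\<^sup>2 - b\<^sup>2 + c\<^sup>2 - d\<^sup>2) *\<^sub>R axis 2 1 +
     (2 * (a * b + c * d)) *\<^sub>R axis 3 1)"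

definition quat_turn :: "complex \<times> complex \<Rightarrow> complex \<times> complex" where
  "quat_turn y = (- snd y, fst y)"

lemma quat_i_turn: "quat_i (quat_turn y) = - quat_i y"
  by (simp add: quat_i_def quat_turn_def Let_def vec_eq_iff forall_3 axis_def algebra_simps)

lemma quat_j_turn: "quat_j (quat_turn y) = quat_j y"
  by (simp add: quat_j_def quat_turn_def Let_def vec_eq_iff forall_3 axis_def algebra_simps)

text \<open>In the four real coordinates both squared lengths are polynomially equal to the square
  of the squared norm of \<open>y\<close>, and the mixed product vanishes identically.\<close>

lemma quat_orthonormal:
  assumes "norm y = 1"
  shows "quat_i y \<bullet> quat_i y = 1" "quat_j y \<bullet> quat_j y = 1" "quat_i y \<bullet> quat_j y = 0"
proof -
  define a b c d where abcd: "a = Re (fst y)" "b = Im (fst y)" "c = Re (snd y)" "d = Im (snd y)"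
  have 1: "a\<^sup>2 + b\<^sup>2 + (c\<^sup>2 + d\<^sup>2) = 1"
    using assms by (simp add: norm_prod_def cmod_def abcd)
  have "quat_i y \<bullet> quat_i y = (a\<^sup>2 + b\<^sup>2 + (c\<^sup>2 + d\<^sup>2))\<^sup>2"
    unfolding quat_i_def Let_def abcd[symmetric] inner_vec_def sum_3
    by (simp add: axis_def power2_eq_square algebra_simps)
  then show "quat_i y \<bullet> quat_i y = 1" using 1 by simp
  have "quat_j y \<bullet> quat_j y = (a\<^sup>2 + b\<^sup>2 + (c\<^sup>2 + d\<^sup>2))\<^sup>2"
    unfolding quat_j_def Let_def abcd[symmetric] inner_vec_def sum_3
    by (simp add: axis_def power2_eq_square algebra_simps)
  then show "quat_j y \<bullet> quat_j y = 1" using 1 by simp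
  show "quat_i y \<bullet> quat_j y = 0"
    unfolding quat_i_def quat_j_def Let_def abcd[symmetric] inner_vec_def sum_3
    by (simp add: axis_def power2_eq_square algebra_simps)
qed

lemma quat_combination_nonzero:
  assumes "norm y = 1" "s \<noteq> 0 \<or> t \<noteq> 0"
  shows "s *\<^sub>R quat_j y + t *\<^sub>R quat_i y \<noteq> 0"
proof
  assume 0: "s *\<^sub>R quat_j y + t *\<^sub>R quat_i y = 0"
  have "(s *\<^sub>R quat_j y + t *\<^sub>R quat_i y) \<bullet> quat_i y = t" "(s *\<^sub>R quat_j y + t *\<^sub>R quat_i y) \<bullet> quat_j y = s"
    using quat_orthonormal[OF assms(1)] by (simp_all add: inner_add_left inner_commute[of "quat_j y" "quat_i y"])
  then show False using 0 assms(2) by auto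
qed

section \<open>The obstruction applied to pairs of frontier points\<close>

lemma coincidence_set_not_split:
  fixes B :: "(real^3) set" and f :: "real^3 \<Rightarrow> real^2"
  assumes B: "convex B" "compact B" and c: "c \<in> interior B"
    and f: "continuous_on (frontier B) f"
    and N: "closed N1" "closed N2" "N1 \<inter> N2 = {}"
    and cover: "\<And>a b. a \<in> frontier B \<Longrightarrow> b \<in> frontier B \<Longrightarrow> f a = f b \<Longrightarrow> (a, b) \<in> N1 \<union> N2"
    and sym: "\<And>a b. (a, b) \<in> N1 \<Longrightarrow> (b, a) \<in> N1" "\<And>a b. (a, b) \<in> N2 \<Longrightarrow> (b, a) \<in> N2"
    and diag: "\<And>a. a \<in> frontier B \<Longrightarrow> (a, a) \<in> N1"
    and anti: "\<And>a b. (a, b) \<in> N1 \<Longrightarrow> \<not> antipodal B c a b"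
  shows False
proof -
  define X :: "(complex \<times> complex) set" where "X = sphere 0 1"
  define \<rho> where "\<rho> = ray_point B c"
  note bc = B c
  obtain \<phi> :: "(real^3) \<times> (real^3) \<Rightarrow> real" where \<phi>: "continuous_on UNIV \<phi>"
    "\<And>x. x \<in> N1 \<Longrightarrow> \<phi> x = -1" "\<And>x. x \<in> N2 \<Longrightarrow> \<phi> x = 1"
    using Urysohn[OF N, of "-1" 1] by metis
  define A where "A p = \<rho> (snd p *\<^sub>R quat_j (fst p) + (1 - snd p) *\<^sub>R quat_i (fst p))" for p :: "(complex \<times> complex) \<times> real"
  define A' where "A' p = \<rho> (snd p *\<^sub>R quat_j (fst p) + (snd p - 1) *\<^sub>R quat_i (fst p))" for p :: "(complex \<times> complex) \<times> real"
  have cq: "continuous_on S quat_i" "continuous_on S quat_j" for S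
    unfolding quat_i_def quat_j_def Let_def by (intro continuous_intros)+
  have cq': "continuous_on S (\<lambda>p. quat_i (fst p))" "continuous_on S (\<lambda>p. quat_j (fst p))"
    for S :: "((complex \<times> complex) \<times> real) set"
    by (intro continuous_on_compose2[OF cq(1)[of UNIV]] continuous_on_compose2[OF cq(2)[of UNIV]] continuous_intros; simp)+
  have cA: "continuous_on (X \<times> {0..1}) A" unfolding A_def \<rho>_def
    by (rule continuous_on_compose2[OF continuous_on_ray_point[OF bc]])
      (auto intro!: continuous_intros cq' simp: X_def quat_combination_nonzero)
  have cA': "continuous_on (X \<times> {0..1}) A'" unfolding A'_def \<rho>_def
    by (rule continuous_on_compose2[OF continuous_on_ray_point[OF bc]])
      (auto intro!: continuous_intros cq' simp: X_def quat_combination_nonzero)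
  have fr: "A p \<in> frontier B" "A' p \<in> frontier B" if "p \<in> X \<times> {0..1}" for p
  proof -
    have n: "norm (fst p) = 1" using that by (auto simp: X_def)
    have "snd p \<noteq> 0 \<or> 1 - snd p \<noteq> 0" "snd p \<noteq> 0 \<or> snd p - 1 \<noteq> 0" by auto
    from this[THEN quat_combination_nonzero[OF n]] show "A p \<in> frontier B" "A' p \<in> frontier B"
      unfolding A_def A'_def \<rho>_def using ray_point[OF bc] by metis+
  qed
  have turn: "A (quat_turn y, s) = A' (y, s)" "A' (quat_turn y, s) = A (y, s)" for y s
    by (simp_all add: A_def A'_def quat_i_turn quat_j_turn) (simp_all add: algebra_simps)
  define g where "g p = Complex ((f (A p) - f (A' p)) $ 1) ((f (A p) - f (A' p)) $ 2)" for p
  \<comment> \<open>The sum over both orders makes \<open>h\<close> invariant under the turn, which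
    exchanges \<open>A\<close> and \<open>A'\<close>. Since \<open>N1\<close> and \<open>N2\<close>
    are symmetric, the values there are -2 and 2.\<close>
  define h where "h p = \<phi> (A p, A' p) + \<phi> (A' p, A p)" for p
  have cover': "(A p, A' p) \<in> N1 \<union> N2" if "g p = 0" "p \<in> X \<times> {0..1}" for p
  proof (rule cover[OF fr[OF that(2)]])
    show "f (A p) = f (A' p)" using that(1) by (simp add: g_def vec_eq_iff forall_2 complex_eq_iff)
  qed
  have h1: "h p = -2" if "(A p, A' p) \<in> N1" for p
    using \<phi>(2) that sym(1) by (simp add: h_def)
  have h2: "h p = 2" if "(A p, A' p) \<in> N2" for p
    using \<phi>(3) that sym(2) by (simp add: h_def)
  show False
  proof (rule quarter_turn_obstruction[of X quat_turn g h])
    show "compact X" "X \<noteq> {}" by (simp_all add: X_def)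
    show "simply_connected X" unfolding X_def by (intro simply_connected_sphere) simp
    show "locally path_connected X" unfolding X_def by (rule locally_path_connected_sphere)
    show "continuous_on X quat_turn" unfolding quat_turn_def by (intro continuous_intros)
    show "quat_turn y \<in> X" if "y \<in> X" for y
      using that by (simp add: X_def quat_turn_def norm_prod_def add.commute)
    show "quat_turn (quat_turn (quat_turn (quat_turn y))) = y" for y
      by (simp add: quat_turn_def)
    have "continuous_on (X \<times> {0..1}) (\<lambda>p. f (A p))" "continuous_on (X \<times> {0..1}) (\<lambda>p. f (A' p))"
      by (intro continuous_on_compose2[OF f] cA cA' image_subsetI fr; assumption)+
    then show "continuous_on (X \<times> {0..1}) g"
      unfolding g_def Complex_eq by (intro continuous_intros)
    show "continuous_on (X \<times> {0..1}) h" unfolding h_def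
      by (intro continuous_intros continuous_on_compose2[OF \<phi>(1)] cA cA') auto
    show "g (quat_turn y, s) = - g (y, s)" "h (quat_turn y, s) = h (y, s)" for y s
      by (simp_all add: g_def h_def turn complex_eq_iff)
    show "h p \<noteq> 0" if "p \<in> X \<times> {0..1}" "g p = 0" for p
      using cover'[OF that(2,1)] h1 h2 by fastforce
    show "0 < h (y, 0)" if y: "y \<in> X" "g (y, 0) = 0" for y
    proof -
      have "quat_i y \<noteq> 0" using quat_combination_nonzero[of y 0 1] y(1) by (simp add: X_def)
      then have "antipodal B c (A (y, 0)) (A' (y, 0))"
        unfolding A_def A'_def \<rho>_def by (simp add: antipodal_ray_point[OF bc])
      then have "(A (y, 0), A' (y, 0)) \<in> N2" using cover'[of "(y, 0)"] y anti by auto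
      then show ?thesis using h2 by simp
    qed
    show "h (y, 1) < 0" if y: "y \<in> X" "g (y, 1) = 0" for y
    proof -
      have "A (y, 1) = A' (y, 1)" by (simp add: A_def A'_def)
      then have "(A (y, 1), A' (y, 1)) \<in> N1" using diag fr(1)[of "(y, 1)"] y by simp
      then show ?thesis using h1 by simp
    qed
  qed
qed

subsection \<open>Affine maps on simplices\<close>

lemma affine_map_on_sum:
  assumes "affine_map_on S f" "sum a C = 1" "C \<subseteq> S" "(\<Sum>v\<in>C. a v *\<^sub>R v) \<in> S"
  shows "f (\<Sum>v\<in>C. a v *\<^sub>R v) = (\<Sum>v\<in>C. a v *\<^sub>R f v)"
proof -
  obtain h b where h: "linear h" "\<And>x. x \<in> S \<Longrightarrow> f x = h x + b"
    using assms(1) by (auto simp: affine_map_on_def)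
  have "(\<Sum>v\<in>C. a v *\<^sub>R f v) = (\<Sum>v\<in>C. a v *\<^sub>R h v) + (\<Sum>v\<in>C. a v) *\<^sub>R b"
    using h(2) assms(3) by (simp add: subset_iff scaleR_add_right sum.distrib scaleR_left.sum)
  also have "\<dots> = f (\<Sum>v\<in>C. a v *\<^sub>R v)"
    using assms by (simp add: h linear_sum linear_scale[OF h(1)])
  finally show ?thesis ..
qed

lemma affine_map_on_subset: "affine_map_on S f \<Longrightarrow> T \<subseteq> S \<Longrightarrow> affine_map_on T f"
  unfolding affine_map_on_def by blast

lemma affine_map_on_combination:
  assumes "affine_map_on S f" "x \<in> S" "y \<in> S" "(1 - t) *\<^sub>R x + t *\<^sub>R y \<in> S"
  shows "f ((1 - t) *\<^sub>R x + t *\<^sub>R y) = (1 - t) *\<^sub>R f x + t *\<^sub>R f y"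
proof -
  obtain h b where h: "linear h" "\<And>x. x \<in> S \<Longrightarrow> f x = h x + b"
    using assms(1) by (auto simp: affine_map_on_def)
  have "f ((1 - t) *\<^sub>R x + t *\<^sub>R y) = (1 - t) *\<^sub>R h x + t *\<^sub>R h y + b"
    by (simp only: h(2)[OF assms(4)] linear_add[OF h(1)] linear_scale[OF h(1)])
  also have "\<dots> = (1 - t) *\<^sub>R (h x + b) + t *\<^sub>R (h y + b)"
    by (simp add: algebra_simps)
  finally show ?thesis using h(2) assms(2,3) by simp
qed

lemma affine_map_on_convex_hull_image:
  assumes "affine_map_on (convex hull C) f"
  shows "f ` (convex hull C) = convex hull (f ` C)"
proof -
  obtain h b where h: "linear h" "\<And>x. x \<in> convex hull C \<Longrightarrow> f x = h x + b"
    using assms(1) by (auto simp: affine_map_on_def)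
  have "f ` (convex hull C) = (\<lambda>x. b + x) ` h ` (convex hull C)"
    by (force simp: h(2) image_iff add.commute)
  also have "\<dots> = convex hull ((\<lambda>x. b + x) ` h ` C)"
    by (simp add: convex_hull_linear_image[OF h(1)] convex_hull_translation)
  also have "(\<lambda>x. b + x) ` h ` C = f ` C"
    using h(2) hull_subset[of C convex] by (force simp: image_iff add.commute subset_iff)
  finally show ?thesis .
qed

lemma affine_map_on_continuous:
  fixes f :: "'a::euclidean_space \<Rightarrow> 'b::euclidean_space"
  assumes "affine_map_on S f"
  shows "continuous_on S f"
proof -
  obtain h b where h: "linear h" "\<And>x. x \<in> S \<Longrightarrow> f x = h x + b"
    using assms(1) by (auto simp: affine_map_on_def)
  have "continuous_on S (\<lambda>x. h x + b)"
    using h(1) by (intro continuous_intros linear_continuous_on) (simp add: linear_conv_bounded_linear)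
  then show ?thesis using h(2) by (simp cong: continuous_on_cong)
qed

text \<open>If two points have the same image, the differences of their barycentric coordinates form
  an affine dependence of the images of \<open>C\<close>, so they all vanish.\<close>

lemma affine_map_on_inj:
  fixes f :: "'a::euclidean_space \<Rightarrow> 'b::euclidean_space"
  assumes f: "affine_map_on (convex hull C) f" and "inj_on f C" and C: "finite C"
    and indep: "\<not> affine_dependent (f ` C)"
  shows "inj_on f (convex hull C)"
proof (rule inj_onI)
  fix x y assume x: "x \<in> convex hull C" and y: "y \<in> convex hull C" and eq: "f x = f y"
  obtain a where a: "sum a C = 1" "x = (\<Sum>v\<in>C. a v *\<^sub>R v)"
    using x convex_hull_finite[OF C] by auto
  obtain b where b: "sum b C = 1" "y = (\<Sum>v\<in>C. b v *\<^sub>R v)"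
    using y convex_hull_finite[OF C] by auto
  have sub: "C \<subseteq> convex hull C" by (rule hull_subset)
  define U where "U z = a (inv_into C f z) - b (inv_into C f z)" for z
  have U: "U (f v) = a v - b v" if "v \<in> C" for v
    using assms(2) that by (simp add: U_def)
  have "sum U (f ` C) = 0"
    using a b by (simp add: sum.reindex[OF assms(2)] U sum_subtractf)
  moreover have "(\<Sum>z\<in>f ` C. U z *\<^sub>R z) = (\<Sum>v\<in>C. a v *\<^sub>R f v) - (\<Sum>v\<in>C. b v *\<^sub>R f v)"
    by (simp add: sum.reindex[OF assms(2)] U scaleR_diff_left sum_subtractf)
  moreover have "\<dots> = 0"
    using affine_map_on_sum[OF f a(1) sub] affine_map_on_sum[OF f b(1) sub] a b x y eq by simp
  ultimately have "\<forall>z\<in>f ` C. U z = 0"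
    using indep affine_dependent_explicit_finite[OF finite_imageI[OF C, of f]] by metis
  then show "x = y" unfolding a(2) b(2) using U by (intro sum.cong) auto
qed

text \<open>A convex combination attains the upper bound \<open>k\<close> of an affine functional
  only if all its weight lies on vertices attaining \<open>k\<close>.\<close>

lemma convex_hull_level_set:
  assumes "finite C" "x \<in> convex hull C" and f: "affine_map_on (convex hull C) f"
    and le: "\<And>v. v \<in> C \<Longrightarrow> n \<bullet> f v \<le> k" and eq: "n \<bullet> f x = k"
  shows "x \<in> convex hull {v \<in> C. n \<bullet> f v = k}"
proof -
  obtain a where a: "\<And>v. v \<in> C \<Longrightarrow> 0 \<le> a v" "sum a C = 1" "x = (\<Sum>v\<in>C. a v *\<^sub>R v)"
    using assms(2) convex_hull_finite[OF assms(1)] by auto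
  define C' where "C' = {v \<in> C. n \<bullet> f v = k}"
  have "f x = (\<Sum>v\<in>C. a v *\<^sub>R f v)"
    using affine_map_on_sum[OF f a(2) hull_subset] a assms(2) by simp
  then have "k * sum a C = (\<Sum>v\<in>C. a v * (n \<bullet> f v))"
    using eq a(2) by (simp add: inner_sum_right)
  then have "(\<Sum>v\<in>C. a v * (k - n \<bullet> f v)) = 0"
    by (simp add: algebra_simps sum_subtractf sum_distrib_left)
  then have "a v * (k - n \<bullet> f v) = 0" if "v \<in> C" for v
    using sum_nonneg_eq_0_iff[OF assms(1), of "\<lambda>v. a v * (k - n \<bullet> f v)"] a(1) le that by simp
  then have 0: "a v = 0" if "v \<in> C - C'" for v using that by (force simp: C'_def)
  have sub: "C' \<subseteq> C" by (auto simp: C'_def)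
  have "sum a C' = 1" "x = (\<Sum>v\<in>C'. a v *\<^sub>R v)"
    using a(2,3) sum.mono_neutral_left[OF assms(1) sub, of a] 
      sum.mono_neutral_left[OF assms(1) sub, of "\<lambda>v. a v *\<^sub>R v"] 0 by auto
  then have "x \<in> convex hull C'"
    using a(1) sub finite_subset[OF sub assms(1)] by (auto simp: convex_hull_finite)
  then show ?thesis by (simp add: C'_def)
qed

section \<open>Dimension and interior of simplices\<close>

lemma simplex_empty_interior:
  fixes S :: "'a::euclidean_space set"
  assumes "n simplex S" "n < int DIM('a)"
  shows "interior S = {}"
  using aff_dim_nonempty_interior aff_dim_simplex[OF assms(1)] assms(2) by fastforce

lemma simplex_dim_le:
  fixes S :: "'a::euclidean_space set"
  shows "n simplex S \<Longrightarrow> n \<le> int DIM('a)"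
  using aff_dim_le_DIM aff_dim_simplex by metis

lemma simplex_interior_nonempty:
  fixes S :: "'a::euclidean_space set"
  assumes "int DIM('a) simplex S"
  shows "interior S \<noteq> {}"
proof -
  obtain C where "\<not> affine_dependent C" "card C = Suc DIM('a)" "S = convex hull C"
    using assms unfolding simplex_def by auto
  then show ?thesis using interior_convex_hull_eq_empty by blast
qed

subsection \<open>Double points of a map in general position\<close>

text \<open>Otherwise some neighborhood of \<open>a\<close> in the frontier would be covered by
  edges and vertices of \<open>K\<close>. The open cone over it, seen from \<open>c\<close>, would
  then lie in finitely many linear subspaces of dimension at most 2, a null set in space.\<close>

lemma frontier_point_in_triangle:
  fixes B :: "(real^3) set"
  assumes B: "polytope B" "interior B \<noteq> {}"
    and K: "simplicial_complex K" "\<Union>K = frontier B" and a: "a \<in> frontier B"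
  obtains S where "S \<in> K" "2 simplex S" "a \<in> S"
proof -
  have conv: "convex B" and comp: "compact B"
    using B by (simp_all add: polytope_imp_convex polytope_imp_compact)
  have fin: "finite K" using K(1) by (simp add: simplicial_complex_def)
  define E where "E = \<Union>{S \<in> K. 2 simplex S}"
  have "closed E" unfolding E_def using fin by (intro closed_Union) (auto intro: closed_simplex)
  have "a \<in> E"
  proof (rule ccontr)
    assume "a \<notin> E"
    obtain c where c: "c \<in> interior B" using B(2) by auto
    note bc = conv comp c
    define W where "W = - {0} \<inter> ray_point B c -` (- E)"
    have "open W" unfolding W_def using \<open>closed E\<close>
      by (intro continuous_open_preimage[OF continuous_on_ray_point[OF bc]]) auto
    moreover have "a - c \<in> W"
      using ray_point_frontier[OF bc a] \<open>a \<notin> E\<close> c a by (auto simp: W_def frontier_def)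
    moreover have "negligible W"
    proof (rule negligible_subset)
      show "negligible (\<Union>S\<in>{S \<in> K. \<not> 2 simplex S}. span ((\<lambda>x. x - c) ` S))"
      proof (intro negligible_Union finite_imageI)
        fix T assume "T \<in> (\<lambda>S. span ((\<lambda>x. x - c) ` S)) ` {S \<in> K. \<not> 2 simplex S}"
        then obtain S where S: "S \<in> K" "\<not> 2 simplex S" "T = span ((\<lambda>x. x - c) ` S)" by auto
        obtain n where n: "n simplex S" using S K(1) by (auto simp: simplicial_complex_def)
        \<comment> \<open>A three-dimensional simplex inside the frontier would give the frontier of
          a convex set positive measure. Excluding it leaves at most two vertices.\<close>
        have "n \<noteq> 3"
        proof
          assume "n = 3"
          then have "interior S \<noteq> {}" using n simplex_interior_nonempty[of S] by simp
          moreover have "S \<subseteq> frontier B" using K(2) S(1) by auto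
          ultimately have "\<not> negligible (frontier B)"
            by (metis convex_simplex n negligible_convex_interior negligible_subset)
          then show False using negligible_convex_frontier conv by blast
        qed
        moreover have "n \<noteq> 2" using S(2) n by auto
        ultimately have "n \<le> 1" using simplex_dim_le[OF n] by simp
        obtain C where C: "finite C" "int (card C) = n + 1" "S = convex hull C"
          using n by (auto simp: simplex)
        have "(\<lambda>x. x - c) ` S \<subseteq> span ((\<lambda>x. x - c) ` C)"
        proof -
          have "(\<lambda>x. - c + x) ` S = convex hull ((\<lambda>x. - c + x) ` C)"
            unfolding C(3) by (rule convex_hull_translation[symmetric])
          then show ?thesis using convex_hull_subset_span[of "(\<lambda>x. - c + x) ` C"] by simp
        qed
        then have "T \<subseteq> span ((\<lambda>x. x - c) ` C)" unfolding S(3) by (simp add: span_minimal)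
        then have "dim T \<le> card ((\<lambda>x. x - c) ` C)" using C by (intro dim_le_card) auto
        also have "\<dots> \<le> card C" using C by (intro card_image_le)
        finally show "negligible T" using C \<open>n \<le> 1\<close> by (intro negligible_lowdim) simp
      qed (use fin in auto)
      show "W \<subseteq> (\<Union>S\<in>{S \<in> K. \<not> 2 simplex S}. span ((\<lambda>x. x - c) ` S))"
      proof
        fix w assume "w \<in> W"
        then have w: "w \<noteq> 0" "ray_point B c w \<notin> E" by (auto simp: W_def)
        obtain t where t: "0 < t" "ray_point B c w = c + t *\<^sub>R w" "ray_point B c w \<in> frontier B"
          using ray_point[OF bc w(1)] .
        obtain S where S: "S \<in> K" "ray_point B c w \<in> S" using t K by blast
        then have "\<not> 2 simplex S" using w by (auto simp: E_def)
        moreover have "t *\<^sub>R w \<in> (\<lambda>x. x - c) ` S" using S(2) t(2) by (force simp: image_iff)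
        then have "(1 / t) *\<^sub>R (t *\<^sub>R w) \<in> span ((\<lambda>x. x - c) ` S)" by (intro span_scale span_base)
        then have "w \<in> span ((\<lambda>x. x - c) ` S)" using t by simp
        ultimately show "w \<in> (\<Union>S\<in>{S \<in> K. \<not> 2 simplex S}. span ((\<lambda>x. x - c) ` S))"
          using S by blast
      qed
    qed
    ultimately show False using open_not_negligible by blast
  qed
  then show ?thesis using that by (auto simp: E_def)
qed

section \<open>Triangles under a map in general position\<close>

context
  fixes K :: "'a::euclidean_space set set" and f :: "'a \<Rightarrow> real^2"
  assumes K: "simplicial_complex K"
    and aff: "\<And>S. S \<in> K \<Longrightarrow> 2 simplex S \<Longrightarrow> affine_map_on S f"
    and gp: "general_position K f"
begin

lemma triangle_vertices:
  assumes S: "S \<in> K" "2 simplex S"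
  obtains u v w where "u \<noteq> v" "u \<noteq> w" "v \<noteq> w" "\<not> affine_dependent {u, v, w}"
    "S = convex hull {u, v, w}" "{u} \<in> K" "{v} \<in> K" "{w} \<in> K" "\<not> collinear {f u, f v, f w}"
proof -
  obtain C where C: "\<not> affine_dependent C" "card C = 3" "S = convex hull C"
    using S(2) by (auto simp: simplex_def)
  obtain u v w where uvw: "C = {u, v, w}" "u \<noteq> v" "u \<noteq> w" "v \<noteq> w"
    using C(2) by (auto simp: card_3_iff)
  have "{x} \<in> K" if "x \<in> C" for x
    using that C extreme_point_of_convex_hull_affine_independent[OF C(1)] S(1) K
    unfolding simplicial_complex_def by (metis face_of_singleton)
  then show ?thesis using that uvw C gp unfolding general_position_def by (metis insertCI)
qed

lemma triangle_image:
  assumes S: "S \<in> K" "2 simplex S"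
  shows "inj_on f S" "convex (f ` S)" "closed (f ` S)" "interior (f ` S) \<noteq> {}" "2 simplex (f ` S)"
proof -
  obtain u v w where uvw: "u \<noteq> v" "u \<noteq> w" "v \<noteq> w" "\<not> affine_dependent {u, v, w}"
    "S = convex hull {u, v, w}" "\<not> collinear {f u, f v, f w}"
    using triangle_vertices[OF S] by metis
  have af: "affine_map_on (convex hull {u, v, w}) f" using aff[OF S] uvw by simp
  have ne: "f u \<noteq> f v" "f u \<noteq> f w" "f v \<noteq> f w" "\<not> affine_dependent {f u, f v, f w}"
    using uvw(6) by (auto simp: collinear_3_eq_affine_dependent)
  show "inj_on f S" unfolding uvw(5)
    by (rule affine_map_on_inj[OF af]) (use ne in auto)
  have im: "f ` S = convex hull {f u, f v, f w}"
    using affine_map_on_convex_hull_image[OF af] uvw(5) by simp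
  show "2 simplex (f ` S)" unfolding simplex_def im
    using ne by (intro exI[of _ "{f u, f v, f w}"]) auto
  then show "convex (f ` S)" "closed (f ` S)" "interior (f ` S) \<noteq> {}"
    using simplex_interior_nonempty[of "f ` S"] by (auto intro: convex_simplex closed_simplex)
qed

text \<open>The given triangle provides a third vertex; its image together with two coinciding
  images would be a collinear triple.\<close>

lemma vertex_image_eq:
  assumes "S \<in> K" "2 simplex S" "{u} \<in> K" "{v} \<in> K" "f u = f v"
  shows "u = v"
proof (rule ccontr)
  assume "u \<noteq> v"
  obtain x where "{x} \<in> K" "x \<noteq> u" "x \<noteq> v"
    using triangle_vertices[OF assms(1,2)] by metis
  then have "\<not> collinear {f u, f v, f x}"
    using gp assms \<open>u \<noteq> v\<close> unfolding general_position_def by metis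
  then show False using assms(5) by (simp add: collinear_3_eq_affine_dependent)
qed

text \<open>A line separating the two images contains the images of at most two vertices, so that both
  points lie on the segment between these.\<close>

lemma double_point_interiors_meet:
  assumes S: "S \<in> K" "2 simplex S" and S': "S' \<in> K" "2 simplex S'"
    and ab: "a \<in> S" "b \<in> S'" "f a = f b" "a \<noteq> b"
  shows "interior (f ` S) \<inter> interior (f ` S') \<noteq> {}"
proof
  assume "interior (f ` S) \<inter> interior (f ` S') = {}"
  then obtain n k where n: "n \<noteq> 0" "\<And>x. x \<in> interior (f ` S) \<Longrightarrow> n \<bullet> x \<le> k"
    "\<And>x. x \<in> interior (f ` S') \<Longrightarrow> n \<bullet> x \<ge> k"
    using separating_hyperplane_sets[of "interior (f ` S)" "interior (f ` S')"]
      triangle_image[OF S] triangle_image[OF S'] convex_interior by metis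
  have "closure (interior (f ` S)) \<subseteq> {x. n \<bullet> x \<le> k}" "closure (interior (f ` S')) \<subseteq> {x. n \<bullet> x \<ge> k}"
    using n(2,3) by (intro closure_minimal closed_halfspace_le closed_halfspace_ge subsetI CollectI; blast)+
  then have le: "\<And>x. x \<in> S \<Longrightarrow> n \<bullet> f x \<le> k" and ge: "\<And>x. x \<in> S' \<Longrightarrow> n \<bullet> f x \<ge> k"
    using triangle_image[OF S] triangle_image[OF S'] by (auto simp: convex_closure_interior)
  have eq: "n \<bullet> f a = k" "n \<bullet> f b = k" using le[OF ab(1)] ge[OF ab(2)] ab(3) by auto
  define W where "W = {v. {v} \<in> K \<and> n \<bullet> f v = k}"
  have W2: "u = v \<or> u = w \<or> v = w" if "u \<in> W" "v \<in> W" "w \<in> W" for u v w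
  proof (rule ccontr)
    assume "\<not> ?thesis"
    then have "\<not> collinear {f u, f v, f w}"
      using gp that unfolding general_position_def W_def by blast
    moreover have "aff_dim {f u, f v, f w} \<le> aff_dim {x. n \<bullet> x = k}"
      using that by (intro aff_dim_subset) (auto simp: W_def)
    ultimately show False using n(1) by (simp add: collinear_aff_dim aff_dim_hyperplane)
  qed
  have hull: "\<exists>V \<subseteq> W. x \<in> convex hull V \<and> convex hull V \<subseteq> T"
    if T: "T \<in> K" "2 simplex T" "x \<in> T" "n \<bullet> f x = k"
      and side: "(\<forall>y\<in>T. n \<bullet> f y \<le> k) \<or> (\<forall>y\<in>T. n \<bullet> f y \<ge> k)" for T x
  proof -
    obtain u v w where uvw: "T = convex hull {u, v, w}" "{u} \<in> K" "{v} \<in> K" "{w} \<in> K"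
      using triangle_vertices[OF T(1,2)] by metis
    have sub: "{u, v, w} \<subseteq> T" unfolding uvw(1) by (rule hull_subset)
    define V where "V = {z \<in> {u, v, w}. n \<bullet> f z = k}"
    \<comment> \<open>With the normal reversed, the level set lemma also covers a triangle on the
      other side of the line.\<close>
    have V': "V = {z \<in> {u, v, w}. (- n) \<bullet> f z = - k}" unfolding V_def by auto
    have af: "affine_map_on (convex hull {u, v, w}) f" using aff[OF T(1,2)] uvw by simp
    have "x \<in> convex hull V"
      using side
    proof
      assume "\<forall>y\<in>T. n \<bullet> f y \<le> k"
      then show ?thesis unfolding V_def using T(3,4) uvw(1) sub
        by (intro convex_hull_level_set af) auto
    next
      assume "\<forall>y\<in>T. n \<bullet> f y \<ge> k"
      then show ?thesis unfolding V' using T(3,4) uvw(1) sub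
        by (intro convex_hull_level_set af) auto
    qed
    moreover have "V \<subseteq> W" using uvw by (auto simp: V_def W_def)
    moreover have "convex hull V \<subseteq> T" unfolding uvw(1) by (intro hull_mono) (auto simp: V_def)
    ultimately show ?thesis by blast
  qed
  obtain V where V: "V \<subseteq> W" "a \<in> convex hull V" "convex hull V \<subseteq> S"
    using hull[OF S ab(1) eq(1)] le by blast
  obtain V' where V': "V' \<subseteq> W" "b \<in> convex hull V'" "convex hull V' \<subseteq> S'"
    using hull[OF S' ab(2) eq(2)] ge by blast
  obtain u where u: "u \<in> V" using V(2) by fastforce
  \<comment> \<open>At most two vertices map to the separating line; if only one of them occurs,
    \<open>w\<close> is \<open>u\<close>.\<close>
  obtain w where w: "V \<union> V' \<subseteq> {u, w}" "w \<in> V \<union> V'"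
    using W2 V(1) V'(1) u by (cases "V \<union> V' \<subseteq> {u}") blast+
  \<comment> \<open>Although \<open>a\<close> and \<open>b\<close> lie in possibly different
    triangles, both get a parameter with respect to the same \<open>u\<close> and \<open>w\<close>,
    and \<open>f\<close> is given by the same formula in it. As \<open>f u \<noteq> f w\<close>,
    equal images then force equal parameters.\<close>
  have line: "\<exists>t. x = (1 - t) *\<^sub>R u + t *\<^sub>R w \<and> f x = (1 - t) *\<^sub>R f u + t *\<^sub>R f w"
    if T: "T \<in> K" "2 simplex T" and Y: "Y \<subseteq> {u, w}" "x \<in> convex hull Y" "convex hull Y \<subseteq> T" for T Y x
  proof -
    consider "Y = {}" | "Y = {u}" | "Y = {w}" | "Y = {u, w}" using Y(1) by blast
    then show ?thesis
    proof cases
      case 2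
      then show ?thesis using Y by (intro exI[of _ 0]) auto
    next
      case 3
      then show ?thesis using Y by (intro exI[of _ 1]) auto
    next
      case 4
      then obtain t where t: "x = (1 - t) *\<^sub>R u + t *\<^sub>R w"
        using Y(2) by (auto simp: segment_convex_hull[symmetric] in_segment)
      have "u \<in> T" "w \<in> T" "x \<in> T" using Y 4 hull_subset[of Y convex] by auto
      then show ?thesis using affine_map_on_combination[OF aff[OF T]] t by blast
    qed (use Y in auto)
  qed
  obtain s where s: "a = (1 - s) *\<^sub>R u + s *\<^sub>R w" "f a = (1 - s) *\<^sub>R f u + s *\<^sub>R f w"
    using line[OF S _ V(2,3)] w by blast
  obtain t where t: "b = (1 - t) *\<^sub>R u + t *\<^sub>R w" "f b = (1 - t) *\<^sub>R f u + t *\<^sub>R f w"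
    using line[OF S' _ V'(2,3)] w by blast
  have "{u} \<in> K" "{w} \<in> K" using u w V(1) V'(1) by (auto simp: W_def)
  moreover have "u \<noteq> w" using s(1) t(1) ab(4) by (auto simp flip: scaleR_add_left)
  ultimately have "f u \<noteq> f w" using vertex_image_eq[OF S] by blast
  have "(s - t) *\<^sub>R (f w - f u) = 0" using s(2) t(2) ab(3) by (simp add: algebra_simps)
  then have "s = t" using \<open>f u \<noteq> f w\<close> by simp
  then show False using s(1) t(1) ab(4) by simp
qed

end

text \<open>Among the segments with distinct end points in \<open>V\<close> that contain
  \<open>x\<close> and lie in the given one, a shortest has no point of \<open>V\<close> inside:
  such a point would split it into two shorter ones, one of which contains \<open>x\<close>.\<close>

lemma segment_subdivision:
  fixes a b :: "'a::euclidean_space"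
  assumes "finite V" "a \<in> V" "b \<in> V" "a \<noteq> b" "x \<in> closed_segment a b"
  obtains p q where "p \<noteq> q" "p \<in> V" "q \<in> V" "open_segment p q \<inter> V = {}"
    "x \<in> closed_segment p q" "closed_segment p q \<subseteq> closed_segment a b"
proof -
  define E where "E = {(p, q) \<in> V \<times> V. p \<noteq> q \<and> x \<in> closed_segment p q \<and>
    closed_segment p q \<subseteq> closed_segment a b}"
  have "finite E" by (rule finite_subset[of _ "V \<times> V"]) (use assms(1) in \<open>auto simp: E_def\<close>)
  moreover have "E \<noteq> {}" using assms by (auto simp: E_def)
  ultimately obtain e where e: "e \<in> E" "\<And>e'. e' \<in> E \<Longrightarrow> \<not> dist (fst e') (snd e') < dist (fst e) (snd e)"
    using arg_min_if_finite[of E "\<lambda>e. dist (fst e) (snd e)"] by metis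
  obtain p q where pq: "e = (p, q)" by (cases e)
  have E: "p \<in> V" "q \<in> V" "p \<noteq> q" "x \<in> closed_segment p q" "closed_segment p q \<subseteq> closed_segment a b"
    using e(1) by (auto simp: E_def pq)
  have "open_segment p q \<inter> V = {}"
  proof (rule ccontr)
    assume "open_segment p q \<inter> V \<noteq> {}"
    then obtain r where r: "r \<in> open_segment p q" "r \<in> V" by auto
    then have rc: "r \<in> closed_segment p q" and ne: "r \<noteq> p" "r \<noteq> q"
      by (auto simp: open_segment_def)
    have un: "closed_segment p r \<union> closed_segment r q = closed_segment p q"
      using Un_closed_segment rc by blast
    have lt: "dist p r < dist p q" "dist r q < dist p q"
      using dist_in_open_segment[OF r(1)] by (auto simp: dist_commute)
    have "x \<in> closed_segment p r \<or> x \<in> closed_segment r q" using un E(4) by blast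
    then show False
    proof
      assume "x \<in> closed_segment p r"
      then have "(p, r) \<in> E" using E r ne un by (auto simp: E_def)
      then show False using e(2)[of "(p, r)"] lt pq by simp
    next
      assume "x \<in> closed_segment r q"
      then have "(r, q) \<in> E" using E r ne un by (auto simp: E_def)
      then show False using e(2)[of "(r, q)"] lt pq by simp
    qed
  qed
  then show ?thesis using that E by blast
qed

text \<open>The vertices of \<open>t\<close> are pulled back along the inverse of \<open>f\<close>
  on \<open>S\<close>. They remain affinely independent because an affine map cannot raise the
  affine dimension.\<close>

lemma affine_map_on_preimage_simplex:
  fixes f :: "'a::euclidean_space \<Rightarrow> 'b::euclidean_space"
  assumes f: "affine_map_on S f" "inj_on f S" and S: "convex S" and t: "n simplex t" "t \<subseteq> f ` S"
  shows "n simplex (S \<inter> f -` t)"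
proof -
  obtain C where C: "\<not> affine_dependent C" "int (card C) = n + 1" "t = convex hull C"
    using t(1) by (auto simp: simplex_def)
  have finC: "finite C" using C(1) by (simp add: aff_independent_finite)
  define G where "G = inv_into S f"
  have CS: "C \<subseteq> f ` S" using t(2) C(3) hull_subset[of C convex] by blast
  have fG: "f ` G ` C = C" using CS by (auto simp: G_def image_image f_inv_into_f subset_iff)
  have GS: "G ` C \<subseteq> S" using CS by (auto simp: G_def inv_into_into)
  have sub: "convex hull (G ` C) \<subseteq> S" using GS S by (rule hull_minimal)
  have af: "affine_map_on (convex hull (G ` C)) f" using f(1) sub affine_map_on_subset by blast
  have im: "f ` (convex hull (G ` C)) = t"
    using affine_map_on_convex_hull_image[OF af] fG C(3) by simp
  have "S \<inter> f -` t = convex hull (G ` C)"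
  proof (intro equalityI subsetI)
    fix x assume "x \<in> S \<inter> f -` t"
    then obtain y where "y \<in> convex hull (G ` C)" "f x = f y" using im by blast
    then show "x \<in> convex hull (G ` C)"
      using f(2) sub \<open>x \<in> S \<inter> f -` t\<close> by (metis IntD1 inj_onD subsetD)
  next
    fix x assume "x \<in> convex hull (G ` C)"
    then show "x \<in> S \<inter> f -` t" using sub im by blast
  qed
  moreover have card: "card (G ` C) = card C"
    unfolding G_def using CS by (intro card_image inj_on_inv_into)
  moreover have "\<not> affine_dependent (G ` C)"
  proof -
    obtain h b where h: "linear h" "\<And>x. x \<in> S \<Longrightarrow> f x = h x + b"
      using f(1) by (auto simp: affine_map_on_def)
    have "f ` G ` C = (\<lambda>x. b + h x) ` G ` C"
      using GS h(2) by (intro image_cong) (auto simp: add.commute)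
    then have "C = (\<lambda>x. b + x) ` h ` G ` C" unfolding fG by (simp add: image_image)
    then have "aff_dim C = aff_dim (h ` G ` C)" by (metis aff_dim_translation_eq)
    also have "\<dots> \<le> aff_dim (G ` C)" by (rule aff_dim_linear_image_le[OF h(1)])
    finally have "int (card (G ` C)) - 1 \<le> aff_dim (G ` C)"
      using C(1) card by (simp add: affine_independent_iff_card)
    then show ?thesis using aff_dim_le_card[of "G ` C"] finC
      by (simp add: affine_independent_iff_card)
  qed
  ultimately show ?thesis unfolding simplex_def using C(2) by (intro exI[of _ "G ` C"]) auto
qed

subsection \<open>The induced triangulation\<close>

context
  fixes K :: "(real^3) set set" and f :: "real^3 \<Rightarrow> real^2" and D :: "(real^2) set set"
  assumes K: "simplicial_complex K"
    and aff: "\<And>S. S \<in> K \<Longrightarrow> 2 simplex S \<Longrightarrow> affine_map_on S f"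
    and gp: "general_position K f"
    and D: "is_cdt_of_image K f D"
begin

lemma cdt:
  shows "simplicial_complex D" "\<Union>D = convex hull crossing_points K f"
    "finite (crossing_points K f)" "edge_image_segments K f \<subseteq> D"
proof -
  show sc: "simplicial_complex D" and "\<Union>D = convex hull crossing_points K f"
    and "edge_image_segments K f \<subseteq> D"
    using D by (auto simp: is_cdt_of_image_def constrained_delaunay_def)
  have "crossing_points K f = (\<lambda>v. {v}) -` D"
    using D by (auto simp: is_cdt_of_image_def constrained_delaunay_def)
  then show "finite (crossing_points K f)"
    using sc by (simp add: simplicial_complex_def finite_vimageI)
qed

text \<open>Two different edges of a triangle meet at each vertex, which makes the image of the
  vertex a crossing point.\<close>

lemma triangle_edges:
  assumes S: "S \<in> K" "2 simplex S"
  obtains u v w where "f ` S = convex hull {f u, f v, f w}"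
    "{f u, f v, f w} \<subseteq> crossing_points K f"
    "\<And>x y. x \<in> {u, v, w} \<Longrightarrow> y \<in> {u, v, w} \<Longrightarrow> x \<noteq> y \<Longrightarrow> f x \<noteq> f y \<and> closed_segment x y \<in> K \<and>
      1 simplex (closed_segment x y) \<and> f ` closed_segment x y = closed_segment (f x) (f y)"
proof -
  obtain u v w where uvw: "u \<noteq> v" "u \<noteq> w" "v \<noteq> w" "\<not> affine_dependent {u, v, w}"
    "S = convex hull {u, v, w}" "\<not> collinear {f u, f v, f w}"
    using triangle_vertices[OF K aff gp S] by metis
  have af: "affine_map_on S f" by (rule aff[OF S])
  have ne: "f u \<noteq> f v" "f u \<noteq> f w" "f v \<noteq> f w"
    using uvw(6) by (auto simp: collinear_3_eq_affine_dependent)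
  have seg: "f x \<noteq> f y \<and> closed_segment x y \<in> K \<and>
      1 simplex (closed_segment x y) \<and> f ` closed_segment x y = closed_segment (f x) (f y)"
    if "x \<in> {u, v, w}" "y \<in> {u, v, w}" "x \<noteq> y" for x y
  proof -
    have sub: "{x, y} \<subseteq> {u, v, w}" using that by auto
    then have "convex hull {x, y} face_of S"
      unfolding uvw(5) face_of_convex_hull_affine_independent[OF uvw(4)] by blast
    then have "closed_segment x y \<in> K"
      using K S unfolding simplicial_complex_def segment_convex_hull by blast
    moreover have "affine_map_on (convex hull {x, y}) f"
      using af affine_map_on_subset hull_mono[OF sub, of convex] uvw(5) by metis
    then have "f ` closed_segment x y = closed_segment (f x) (f y)"
      unfolding segment_convex_hull by (simp add: affine_map_on_convex_hull_image)
    ultimately show ?thesis using one_simplex_segment that ne by fastforce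
  qed
  have V: "f x \<in> crossing_points K f" if "{x, y, z} = {u, v, w}" "x \<noteq> y" "x \<noteq> z" "y \<noteq> z" for x y z
  proof -
    have xyz: "x \<in> {u, v, w}" "y \<in> {u, v, w}" "z \<in> {u, v, w}" using that by auto
    have "closed_segment x y \<noteq> closed_segment x z" using that by (auto simp: doubleton_eq_iff)
    moreover have "f x \<in> f ` closed_segment x y" "f x \<in> f ` closed_segment x z" by auto
    ultimately show ?thesis unfolding crossing_points_def
      using seg[OF xyz(1,2) that(2)] seg[OF xyz(1,3) that(3)] by blast
  qed
  have "f ` S = convex hull {f u, f v, f w}"
    using affine_map_on_convex_hull_image[of "{u, v, w}"] af uvw(5) by simp
  moreover have "{f u, f v, f w} \<subseteq> crossing_points K f"
    using V[of u v w] V[of v u w] V[of w u v] uvw(1-3) by (simp add: insert_commute)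
  ultimately show ?thesis using seg by (rule that)
qed

text \<open>The frontier of the image triangle is made up of edge images. Cut at the crossing
  points, these become constraint segments, which belong to \<open>D\<close>.\<close>

lemma frontier_image_in_edge:
  assumes S: "S \<in> K" "2 simplex S" and x: "x \<in> frontier (f ` S)"
  obtains s where "s \<in> D" "1 simplex s" "x \<in> s"
proof -
  obtain u v w where im: "f ` S = convex hull {f u, f v, f w}"
    and V: "{f u, f v, f w} \<subseteq> crossing_points K f"
    and seg: "\<And>x y. x \<in> {u, v, w} \<Longrightarrow> y \<in> {u, v, w} \<Longrightarrow> x \<noteq> y \<Longrightarrow> f x \<noteq> f y \<and> closed_segment x y \<in> K \<and>
      1 simplex (closed_segment x y) \<and> f ` closed_segment x y = closed_segment (f x) (f y)"
    using triangle_edges[OF S] by metis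
  have dim: "aff_dim (f ` S) = 2"
    using triangle_image(5)[OF K aff gp S] aff_dim_simplex by blast
  have ne: "u \<noteq> v" "u \<noteq> w" "v \<noteq> w"
  proof -
    have "\<not> collinear {f u, f v, f w}"
      using dim unfolding im by (simp add: collinear_aff_dim aff_dim_convex_hull)
    then show "u \<noteq> v" "u \<noteq> w" "v \<noteq> w" by (auto simp: collinear_3_eq_affine_dependent)
  qed
  have "x \<in> closed_segment (f u) (f v) \<union> closed_segment (f v) (f w) \<union> closed_segment (f w) (f u)"
    using x unfolding im by (subst (asm) frontier_of_triangle) auto
  then obtain y z where yz: "x \<in> closed_segment (f y) (f z)" "y \<in> {u, v, w}" "z \<in> {u, v, w}" "y \<noteq> z"
    using ne by blast
  have "f y \<in> crossing_points K f" "f z \<in> crossing_points K f" using yz V by auto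
  then obtain p q where pq: "p \<noteq> q" "p \<in> crossing_points K f" "q \<in> crossing_points K f"
    "open_segment p q \<inter> crossing_points K f = {}"
    "x \<in> closed_segment p q" "closed_segment p q \<subseteq> closed_segment (f y) (f z)"
    using segment_subdivision[OF cdt(3) _ _ _ yz(1)] seg[OF yz(2-4)] by metis
  have "\<exists>e\<in>K. 1 simplex e \<and> closed_segment p q \<subseteq> f ` e"
    using seg[OF yz(2-4)] pq(6) by (intro bexI[of _ "closed_segment y z"]) auto
  then have "closed_segment p q \<in> edge_image_segments K f"
    unfolding edge_image_segments_def using pq(1-4) by blast
  then have "closed_segment p q \<in> D" using cdt(4) by auto
  then show ?thesis using that one_simplex_segment[OF pq(1)] pq(5) by blast
qed

lemma cdt_triangle_subset_image:
  assumes S: "S \<in> K" "2 simplex S" and t: "t \<in> D" "2 simplex t"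
    and meet: "interior t \<inter> interior (f ` S) \<noteq> {}"
  shows "t \<subseteq> f ` S"
proof -
  note fS = triangle_image[OF K aff gp S]
  have "interior t \<inter> frontier (f ` S) = {}"
  proof (rule ccontr)
    assume "interior t \<inter> frontier (f ` S) \<noteq> {}"
    then obtain x where x: "x \<in> interior t" "x \<in> frontier (f ` S)" by auto
    obtain s where s: "s \<in> D" "1 simplex s" "x \<in> s"
      using frontier_image_in_edge[OF S x(2)] .
    \<comment> \<open>A face of \<open>t\<close> containing an interior point of \<open>t\<close> is
      all of \<open>t\<close>, and \<open>t\<close> does not fit into an edge.\<close>
    have "t \<inter> s face_of t" using cdt(1) t s by (simp add: simplicial_complex_def)
    moreover have "x \<in> (t \<inter> s) \<inter> interior t" using x s interior_subset by blast
    ultimately have "t \<inter> s = t" using face_of_disjoint_interior by blast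
    then have "aff_dim t \<le> aff_dim s" by (intro aff_dim_subset) auto
    then show False using aff_dim_simplex[OF t(2)] aff_dim_simplex[OF s(2)] by simp
  qed
  moreover have "connected (interior t)"
    using t(2) by (intro convex_connected convex_interior convex_simplex)
  moreover have "interior t \<inter> f ` S \<noteq> {}" using meet interior_subset by blast
  ultimately have "interior t \<subseteq> f ` S" using connected_Int_frontier by blast
  then have "closure (interior t) \<subseteq> f ` S" using fS(3) by (rule closure_minimal)
  moreover have "closure (interior t) = t"
    using t(2) simplex_interior_nonempty[of t] by (simp add: convex_closure_interior convex_simplex closed_simplex)
  ultimately show ?thesis by simp
qed

text \<open>The two image triangles have intersecting interiors, so \<open>f a\<close> is a limit of
  points of the open set \<open>U\<close>. Outside a null set, \<open>U\<close> is covered by the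
  triangles of \<open>D\<close> that meet it; their finite union is closed, hence contains
  \<open>U\<close> and \<open>f a\<close>. Each of these triangles lies in both images.\<close>

lemma common_cdt_triangle:
  assumes S: "S \<in> K" "2 simplex S" and S': "S' \<in> K" "2 simplex S'"
    and ab: "a \<in> S" "b \<in> S'" "f a = f b" "a \<noteq> b"
  obtains t where "t \<in> D" "2 simplex t" "f a \<in> t" "t \<subseteq> f ` S" "t \<subseteq> f ` S'"
proof -
  note fS = triangle_image[OF K aff gp S] and fS' = triangle_image[OF K aff gp S']
  define U where "U = interior (f ` S) \<inter> interior (f ` S')"
  have "U \<noteq> {}" unfolding U_def by (rule double_point_interiors_meet[OF K aff gp S S' ab])
  have "open U" unfolding U_def by (intro open_Int open_interior)
  have "f ` S \<inter> f ` S' \<subseteq> closure (f ` S \<inter> f ` S')" by (rule closure_subset)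
  also have "\<dots> = closure U"
    using convex_closure_interior[of "f ` S \<inter> f ` S'"] fS(2) fS'(2) \<open>U \<noteq> {}\<close>
    by (simp add: U_def convex_Int)
  finally have aU: "f a \<in> closure U" using ab by blast
  define T where "T = {t \<in> D. 2 simplex t \<and> interior t \<inter> U \<noteq> {}}"
  define L where "L = \<Union>{s \<in> D. \<not> 2 simplex s}"
  have finD: "finite D" using cdt(1) by (simp add: simplicial_complex_def)
  have clT: "closed (\<Union>T)" using finD by (intro closed_Union) (auto simp: T_def intro: closed_simplex)
  have "negligible L" unfolding L_def
  proof (intro negligible_Union)
    fix s assume "s \<in> {s \<in> D. \<not> 2 simplex s}"
    then have s: "s \<in> D" "\<not> 2 simplex s" by auto
    then have "\<exists>n. n simplex s" using cdt(1) by (simp add: simplicial_complex_def)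
    then obtain n where n: "n simplex s" "n \<noteq> 2" using s(2) by blast
    then have "n < 2" using simplex_dim_le[OF n(1)] by simp
    then have "interior s = {}" using simplex_empty_interior[OF n(1)] by simp
    then show "negligible s" using negligible_convex_interior convex_simplex n(1) by blast
  qed (use finD in auto)
  have "U - L \<subseteq> \<Union>T"
  proof
    fix x assume x: "x \<in> U - L"
    obtain u v w where "f ` S = convex hull {f u, f v, f w}" "{f u, f v, f w} \<subseteq> crossing_points K f"
      using triangle_edges[OF S] by metis
    then have "f ` S \<subseteq> \<Union>D" using cdt(2) hull_mono by metis
    then obtain t where t: "t \<in> D" "x \<in> t" using x interior_subset unfolding U_def by blast
    then have t2: "2 simplex t" using x by (auto simp: L_def)
    have "t = closure (interior t)"
      using t2 simplex_interior_nonempty[of t] by (simp add: convex_closure_interior convex_simplex closed_simplex)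
    then have "interior t \<inter> U \<noteq> {}"
      using open_Int_closure_eq_empty[OF \<open>open U\<close>, of "interior t"] t x by blast
    then show "x \<in> \<Union>T" using t t2 by (auto simp: T_def)
  qed
  then have "negligible (U - \<Union>T)"
    using \<open>negligible L\<close> by (auto intro: negligible_subset)
  moreover have "open (U - \<Union>T)" using \<open>open U\<close> clT by blast
  ultimately have "U \<subseteq> \<Union>T" using open_not_negligible by blast
  then have "f a \<in> \<Union>T" using aU clT closure_minimal by blast
  then obtain t where t: "t \<in> D" "2 simplex t" "interior t \<inter> U \<noteq> {}" "f a \<in> t" by (auto simp: T_def)
  then have "interior t \<inter> interior (f ` S) \<noteq> {}" "interior t \<inter> interior (f ` S') \<noteq> {}"
    by (auto simp: U_def)
  then show ?thesis
    using that t cdt_triangle_subset_image[OF S t(1,2)] cdt_triangle_subset_image[OF S' t(1,2)] by blast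
qed

text \<open>The inverse of \<open>f\<close> on the compact triangle \<open>S\<close> is continuous.
  It maps the relative interior of \<open>t\<close> into the preimage used in the definition, and
  therefore maps \<open>t\<close> into the closure.\<close>

lemma induced_triangle:
  assumes S: "S \<in> K" "2 simplex S" and t: "t \<in> D" "2 simplex t" "t \<subseteq> f ` S"
  shows "S \<inter> f -` t \<in> induced_triangles K f D" "f ` (S \<inter> f -` t) = t"
proof -
  note fS = triangle_image[OF K aff gp S]
  show im: "f ` (S \<inter> f -` t) = t" using t(3) by blast
  have bij: "bij_betw f (S \<inter> f -` t) t"
    using fS(1) im by (auto simp: bij_betw_def intro: inj_on_subset)
  have cont: "continuous_on S f" using aff[OF S] by (rule affine_map_on_continuous)
  define G where "G = inv_into S f"
  have cG: "continuous_on (f ` S) G" unfolding G_def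
    using fS(1) cont compact_simplex[OF S(2)] by (intro continuous_on_inv) auto
  have t_cl: "closure (rel_interior t) = t"
    using t(2) convex_closure_rel_interior[of t] by (simp add: convex_simplex closed_simplex)
  have "G ` closure (rel_interior t) \<subseteq> closure {x \<in> \<Union>K. f x \<in> rel_interior t}"
  proof (rule image_closure_subset)
    show "continuous_on (closure (rel_interior t)) G" using cG t(3) t_cl continuous_on_subset by metis
    show "G ` rel_interior t \<subseteq> closure {x \<in> \<Union>K. f x \<in> rel_interior t}"
    proof (rule order_trans[OF _ closure_subset], rule image_subsetI)
      fix z assume z: "z \<in> rel_interior t"
      then have "z \<in> f ` S" using t(3) rel_interior_subset by blast
      then have "G z \<in> S" "f (G z) = z" by (auto simp: G_def f_inv_into_f inv_into_into)
      then show "G z \<in> {x \<in> \<Union>K. f x \<in> rel_interior t}" using z S(1) by auto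
    qed
  qed simp
  moreover have "x \<in> G ` t" if "x \<in> S \<inter> f -` t" for x
    using that fS(1) by (auto simp: G_def intro!: image_eqI[of _ _ "f x"])
  ultimately have "S \<inter> f -` t \<subseteq> closure {x \<in> \<Union>K. f x \<in> rel_interior t}"
    unfolding t_cl by blast
  moreover have "2 simplex (S \<inter> f -` t)"
    using S t(2,3) fS(1) aff[OF S] by (intro affine_map_on_preimage_simplex) (auto intro: convex_simplex)
  moreover have "t \<in> image_triangulation K f D"
    using t(1,3) S(1) unfolding image_triangulation_def by blast
  ultimately show "S \<inter> f -` t \<in> induced_triangles K f D"
    unfolding induced_triangles_def using t(2) S bij by blast
qed

lemma double_point_in_neighbor_triangle:
  assumes S: "S \<in> K" "2 simplex S" and S': "S' \<in> K" "2 simplex S'"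
    and ab: "a \<in> S" "b \<in> S'" "f a = f b" "a \<noteq> b"
  obtains A B where "A \<in> induced_triangles K f D" "B \<in> induced_triangles K f D" "A \<noteq> B"
    "f ` A = f ` B" "(a, b) \<in> neighbor_triangle f A B"
proof -
  obtain t where t: "t \<in> D" "2 simplex t" "f a \<in> t" "t \<subseteq> f ` S" "t \<subseteq> f ` S'"
    using common_cdt_triangle[OF S S' ab] .
  note A = induced_triangle[OF S t(1,2,4)] and B = induced_triangle[OF S' t(1,2,5)]
  have "(a, b) \<in> neighbor_triangle f (S \<inter> f -` t) (S' \<inter> f -` t)"
    using ab t(3) by (auto simp: neighbor_triangle_def)
  \<comment> \<open>If the two pieces coincided, \<open>S\<close> would contain both
    \<open>a\<close> and \<open>b\<close>, against injectivity of \<open>f\<close> on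
    \<open>S\<close>.\<close>
  moreover have "S \<inter> f -` t \<noteq> S' \<inter> f -` t"
  proof
    assume "S \<inter> f -` t = S' \<inter> f -` t"
    then have "b \<in> S" using ab t(3) by auto
    then show False using triangle_image(1)[OF K aff gp S] ab by (auto dest: inj_onD)
  qed
  ultimately show ?thesis using that A B by metis
qed

text \<open>As \<open>f\<close> is injective on \<open>S\<close> and already maps \<open>A\<close>
  onto \<open>t\<close>, nothing else in \<open>S\<close> lies over \<open>t\<close>. So
  \<open>A\<close> is determined by \<open>S\<close> and \<open>t\<close>, which also bounds the
  number of induced triangles.\<close>

lemma induced_triangle_cases:
  assumes "A \<in> induced_triangles K f D"
  obtains S t where "S \<in> K" "2 simplex S" "t \<in> D" "A \<subseteq> S" "A = S \<inter> f -` t" "2 simplex A"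
proof -
  obtain t S where *: "2 simplex A" "t \<in> D" "S \<in> K" "2 simplex S" "A \<subseteq> S" "bij_betw f A t"
    using assms by (auto simp: induced_triangles_def image_triangulation_def)
  have "S \<inter> f -` t \<subseteq> A"
  proof
    fix x assume x: "x \<in> S \<inter> f -` t"
    then obtain y where "y \<in> A" "f y = f x" using *(6) by (auto simp: bij_betw_def)
    then show "x \<in> A"
      using triangle_image(1)[OF K aff gp *(3,4)] *(5) x by (metis IntD1 inj_onD subsetD)
  qed
  then have "A = S \<inter> f -` t" using * by (auto simp: bij_betw_def)
  then show ?thesis using that * by blast
qed

lemma finite_induced_triangles: "finite (induced_triangles K f D)"
proof (rule finite_subset)
  show "induced_triangles K f D \<subseteq> (\<lambda>(S, t). S \<inter> f -` t) ` (K \<times> D)"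
  proof
    fix A assume "A \<in> induced_triangles K f D"
    then show "A \<in> (\<lambda>(S, t). S \<inter> f -` t) ` (K \<times> D)"
      by (rule induced_triangle_cases) auto
  qed
  show "finite ((\<lambda>(S, t). S \<inter> f -` t) ` (K \<times> D))"
    using K cdt(1) by (auto simp: simplicial_complex_def)
qed

text \<open>This is the zero set of the affine map \<open>f a - f b\<close> on the product of two
  compact convex sets.\<close>

lemma neighbor_triangle_closed_convex:
  assumes A: "A \<in> induced_triangles K f D" and B: "B \<in> induced_triangles K f D"
  shows "closed (neighbor_triangle f A B)" "convex (neighbor_triangle f A B)"
proof -
  have *: "compact X \<and> convex X \<and> affine_map_on X f" if X: "X \<in> induced_triangles K f D" for X
    using X by (rule induced_triangle_cases)
      (blast intro: compact_simplex convex_simplex affine_map_on_subset[OF aff])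
  note A' = *[OF A] and B' = *[OF B]
  have eq: "neighbor_triangle f A B = {p \<in> A \<times> B. f (fst p) - f (snd p) = 0}"
    by (auto simp: neighbor_triangle_def)
  have "continuous_on (A \<times> B) (\<lambda>p. f (fst p) - f (snd p))"
    using A' B' affine_map_on_continuous
    by (intro continuous_intros continuous_on_compose2[of A f _ fst] continuous_on_compose2[of B f _ snd]) auto
  then show "closed (neighbor_triangle f A B)"
    unfolding eq using A' B'
    by (intro continuous_closed_preimage_constant) (auto intro: closed_Times compact_imp_closed)
  show "convex (neighbor_triangle f A B)"
  proof (rule convexI)
    fix x y :: "(real^3) \<times> (real^3)" and s t :: real
    assume xy: "x \<in> neighbor_triangle f A B" "y \<in> neighbor_triangle f A B"
      and st: "0 \<le> s" "0 \<le> t" "s + t = 1"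
    have s: "s = 1 - t" using st by simp
    obtain a b a' b' where ab: "x = (a, b)" "y = (a', b')" "a \<in> A" "a' \<in> A" "b \<in> B" "b' \<in> B"
      "f a = f b" "f a' = f b'"
      using xy by (auto simp: neighbor_triangle_def)
    have in_A: "(1 - t) *\<^sub>R a + t *\<^sub>R a' \<in> A" and in_B: "(1 - t) *\<^sub>R b + t *\<^sub>R b' \<in> B"
      using A' B' ab st by (auto intro!: convexD)
    have "f ((1 - t) *\<^sub>R a + t *\<^sub>R a') = f ((1 - t) *\<^sub>R b + t *\<^sub>R b')"
      using affine_map_on_combination[of A f a a' t] affine_map_on_combination[of B f b b' t]
        A' B' ab in_A in_B by simp
    then show "s *\<^sub>R x + t *\<^sub>R y \<in> neighbor_triangle f A B"
      using in_A in_B unfolding ab s by (simp add: neighbor_triangle_def)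
  qed
qed

end

subsection \<open>Paths in the complex of neighbors\<close>

text \<open>Exchanging coordinates is linear, so it carries line paths to line paths and respects
  joins.\<close>

lemma polygonal_path_swap:
  "polygonal_path (g :: real \<Rightarrow> 'a::real_normed_vector \<times> 'a) \<Longrightarrow> polygonal_path (prod.swap \<circ> g)"
proof (induction rule: polygonal_path.induct)
  case (1 a b)
  have "prod.swap \<circ> linepath a b = linepath (prod.swap a) (prod.swap b)"
    by (auto simp: linepath_def fun_eq_iff prod_eq_iff)
  then show ?case by (simp add: polygonal_path.intros)
next
  case (2 g b a)
  have "prod.swap \<circ> linepath a b = linepath (prod.swap a) (prod.swap b)"
    by (auto simp: linepath_def fun_eq_iff prod_eq_iff)
  moreover have "polygonal_path (linepath (prod.swap a) (prod.swap b) +++ (prod.swap \<circ> g))"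
    by (rule polygonal_path.intros(2)[OF 2(3)]) (use 2 in \<open>simp add: pathstart_def\<close>)
  ultimately show ?case by (simp add: path_compose_join)
qed

theorem theorem4:
  fixes B :: "(real^3) set" and K :: "(real^3) set set"
    and d :: "real^3 \<Rightarrow> real^3 \<Rightarrow> real" and c :: "real^3"
    and f :: "real^3 \<Rightarrow> real^2" and D :: "(real^2) set set"
  assumes "polytope B" and "interior B \<noteq> {}"
    and "simplicial_complex K" and "\<Union>K = frontier B"
    and "Metric_space (frontier B) d"
    and "Metric_space.mtopology (frontier B) d = top_of_set (frontier B)"
    and "is_center B d c"
    and "continuous_on (frontier B) f"
    and "\<And>S. S \<in> K \<Longrightarrow> 2 simplex S \<Longrightarrow> affine_map_on S f"
    and "general_position K f"
    and "is_cdt_of_image K f D"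
  shows "\<exists>g p q r. polygonal_path g \<and> path_image g \<subseteq> \<Union>(neighbor_complex K f D) \<and>
           pathstart g = (p, q) \<and> antipodal B c p q \<and> pathfinish g = (r, r)"
proof (rule ccontr)
  assume no_path: "\<not> ?thesis"
  note K = assms(3) and aff = assms(9) and gp = assms(10) and D = assms(11)
  note ctx = K aff gp D
  have c: "c \<in> interior B" using assms(7) by (simp add: is_center_def)
  have conv: "convex B" and comp: "compact B"
    using assms(1) by (simp_all add: polytope_imp_convex polytope_imp_compact)
  define I where "I = {(X, Y) \<in> induced_triangles K f D \<times> induced_triangles K f D. X \<noteq> Y \<and> f ` X = f ` Y}"
  define T where "T i = neighbor_triangle f (fst i) (snd i)" for i
  have "finite I"
    by (rule finite_subset[OF _ finite_cartesian_product[OF finite_induced_triangles[OF ctx] finite_induced_triangles[OF ctx]]])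
      (auto simp: I_def)
  have T: "closed (T i)" "convex (T i)" if "i \<in> I" for i
    using that neighbor_triangle_closed_convex[OF ctx] by (auto simp: I_def T_def)
  have T_sub: "T i \<subseteq> \<Union>(neighbor_complex K f D)" if "i \<in> I" for i
  proof
    fix z assume "z \<in> T i"
    moreover have "T i face_of neighbor_triangle f (fst i) (snd i)"
      unfolding T_def[symmetric] using T(2)[OF that] by (rule face_of_refl)
    moreover have "fst i \<in> induced_triangles K f D" "snd i \<in> induced_triangles K f D"
      "fst i \<noteq> snd i" "f ` fst i = f ` snd i"
      using that by (simp_all add: I_def case_prod_beta mem_Times_iff)
    ultimately have "T i \<in> neighbor_complex K f D" unfolding neighbor_complex_def by blast
    then show "z \<in> \<Union>(neighbor_complex K f D)" using \<open>z \<in> T i\<close> by blast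
  qed
  have sub_T: "\<exists>i\<in>I. z \<in> T i" if z: "z \<in> \<Union>(neighbor_complex K f D)" for z
  proof -
    obtain F X Y where F: "z \<in> F" "X \<in> induced_triangles K f D" "Y \<in> induced_triangles K f D"
      "X \<noteq> Y" "f ` X = f ` Y" "F face_of neighbor_triangle f X Y"
      using z unfolding neighbor_complex_def by blast
    then have "(X, Y) \<in> I" "z \<in> T (X, Y)"
      using face_of_imp_subset[OF F(6)] by (auto simp: I_def T_def)
    then show ?thesis by blast
  qed
  have swap_T: "(y, x) \<in> T (prod.swap i)" if "(x, y) \<in> T i" for x y i
    using that by (auto simp: T_def neighbor_triangle_def)
  have swap_I: "prod.swap i \<in> I" if "i \<in> I" for i
    using that by (simp add: I_def case_prod_beta mem_Times_iff not_sym)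
  define reach where "reach z \<longleftrightarrow> (\<exists>g r. polygonal_path g \<and> path_image g \<subseteq> \<Union>(neighbor_complex K f D) \<and>
    pathstart g = z \<and> pathfinish g = (r, r))" for z
  have lp: "path_image (linepath z w) \<subseteq> \<Union>(neighbor_complex K f D)"
    if "i \<in> I" "z \<in> T i" "w \<in> T i" for i z w
  proof -
    have "closed_segment z w \<subseteq> T i" using that T(2) by (simp add: closed_segment_subset)
    then show ?thesis using T_sub[OF that(1)] by auto
  qed
  have reach_diag: "reach (x, x)" if "i \<in> I" "(x, x) \<in> T i" for i x
    unfolding reach_def
    using lp[OF that that(2)] by (intro exI[of _ "linepath (x, x) (x, x)"] exI[of _ x]) (auto intro: polygonal_path.intros)
  have reach_step: "reach z" if "i \<in> I" "z \<in> T i" "w \<in> T i" "reach w" for i z w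
  proof -
    obtain g r where "polygonal_path g" "path_image g \<subseteq> \<Union>(neighbor_complex K f D)"
      "pathstart g = w" "pathfinish g = (r, r)"
      using \<open>reach w\<close> unfolding reach_def by blast
    then show ?thesis unfolding reach_def using lp[OF that(1-3)]
      by (intro exI[of _ "linepath z w +++ g"] exI[of _ r])
        (auto simp: path_image_join intro: polygonal_path.intros)
  qed
  have reach_swap: "reach (y, x)" if xy: "reach (x, y)" for x y
  proof -
    obtain g r where g: "polygonal_path g" "path_image g \<subseteq> \<Union>(neighbor_complex K f D)"
      "pathstart g = (x, y)" "pathfinish g = (r, r)"
      using xy unfolding reach_def by blast
    have "path_image (prod.swap \<circ> g) \<subseteq> \<Union>(neighbor_complex K f D)"
    proof -
      have "prod.swap z \<in> \<Union>(neighbor_complex K f D)" if z: "z \<in> path_image g" for z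
      proof -
        obtain i where "i \<in> I" "z \<in> T i" using z g(2) sub_T by blast
        then show ?thesis using swap_T[of "fst z" "snd z" i] swap_I T_sub[of "prod.swap i"]
          by (cases z) auto
      qed
      then show ?thesis by (auto simp: path_image_compose)
    qed
    then show ?thesis unfolding reach_def using polygonal_path_swap[OF g(1)] g(3,4)
      by (intro exI[of _ "prod.swap \<circ> g"] exI[of _ r]) (simp add: pathstart_compose pathfinish_compose)
  qed
  \<comment> \<open>Each \<open>T i\<close> is convex and lies in the complex, so a segment joins
    any two of its points. Hence as soon as one point of \<open>T i\<close> reaches the diagonal,
    all of them do.\<close>
  define good where "good i \<longleftrightarrow> (\<exists>w\<in>T i. reach w)" for i
  have good_swap: "good (prod.swap i)" if "good i" for i
    using that reach_swap swap_T unfolding good_def by (metis surj_pair)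
  \<comment> \<open>The diagonal is added separately because its points need not lie in the complex
    of neighbors.\<close>
  define N1 where "N1 = (\<lambda>x. (x, x)) ` frontier B \<union> (\<Union>i\<in>{i \<in> I. good i}. T i)"
  define N2 where "N2 = (\<Union>i\<in>{i \<in> I. \<not> good i}. T i)"
  \<comment> \<open>A diagonal point inside some \<open>T i\<close> reaches the diagonal by a
    constant path. So \<open>N1\<close> meets no triangle that fails to be good, which gives
    disjointness from \<open>N2\<close>.\<close>
  have N1_reach: "reach z" if "z \<in> N1" "i \<in> I" "z \<in> T i" for z i
    using that reach_diag reach_step unfolding N1_def good_def by blast
  show False
  proof (rule coincidence_set_not_split[OF conv comp c assms(8), of N1 N2])
    have "compact ((\<lambda>x. (x, x)) ` frontier B)"
      using comp by (intro compact_continuous_image continuous_intros compact_frontier)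
    then show "closed N1" unfolding N1_def
      using \<open>finite I\<close> T(1) by (intro closed_Un closed_UN) (auto intro: compact_imp_closed)
    show "closed N2" unfolding N2_def using \<open>finite I\<close> T(1) by (intro closed_UN) auto
    show "N1 \<inter> N2 = {}" using N1_reach unfolding N2_def good_def by blast
    show "(a, b) \<in> N1 \<union> N2" if ab: "a \<in> frontier B" "b \<in> frontier B" "f a = f b" for a b
    proof (cases "a = b")
      case True
      then show ?thesis using ab by (auto simp: N1_def)
    next
      case False
      obtain S where S: "S \<in> K" "2 simplex S" "a \<in> S"
        using frontier_point_in_triangle[OF assms(1-4) ab(1)] .
      obtain S' where S': "S' \<in> K" "2 simplex S'" "b \<in> S'"
        using frontier_point_in_triangle[OF assms(1-4) ab(2)] .
      obtain X Y where "X \<in> induced_triangles K f D" "Y \<in> induced_triangles K f D" "X \<noteq> Y"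
          "f ` X = f ` Y" "(a, b) \<in> neighbor_triangle f X Y"
        using double_point_in_neighbor_triangle[OF ctx S(1,2) S'(1,2) S(3) S'(3) ab(3) False] .
      then have "(X, Y) \<in> I" "(a, b) \<in> T (X, Y)" by (auto simp: I_def T_def)
      then show ?thesis unfolding N1_def N2_def by blast
    qed
    show "(b, a) \<in> N1" if "(a, b) \<in> N1" for a b
      using that swap_T swap_I good_swap unfolding N1_def by blast
    show "(b, a) \<in> N2" if ab: "(a, b) \<in> N2" for a b
    proof -
      obtain i where "i \<in> I" "\<not> good i" "(a, b) \<in> T i" using ab by (auto simp: N2_def)
      moreover from this have "\<not> good (prod.swap i)" using good_swap[of "prod.swap i"] by auto
      ultimately show ?thesis using swap_T swap_I unfolding N2_def by blast
    qed
    show "(a, a) \<in> N1" if "a \<in> frontier B" for a using that by (auto simp: N1_def)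
    show "\<not> antipodal B c a b" if ab: "(a, b) \<in> N1" for a b
    proof
      assume anti: "antipodal B c a b"
      \<comment> \<open>An antipodal pair is off the diagonal, so as a point of \<open>N1\<close> it
        lies in a good triangle; the path to the diagonal is then the excluded one.\<close>
      then have "a \<noteq> b" using not_antipodal_self[OF conv comp c] by blast
      then obtain i where "i \<in> I" "(a, b) \<in> T i" using ab by (auto simp: N1_def)
      then have "reach (a, b)" using N1_reach ab by blast
      then show False using no_path anti unfolding reach_def by blast
    qed
  qed
qed

end
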